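(* Let $k\geq2$ and let $L=(l_1,\dots,l_k)$ be generic and reduced positive integers with sum $n$. Let $H_0^L=\{x\in\mathbb{R}^k : x_1l_1+\dots+x_kl_k=0\}$. Then there is an isomorphism of groups $H_1(Tonn^{n,k}(L);\mathbb{Z})\cong H_0^L\cap\mathbb{Z}^k$, and $H_0^L\cap\mathbb{Z}^k$ is a free abelian group of rank $k-1$. (Explicitly, the class of the closed path making $p_i\geq0$ steps of type $i$, with $\sum p_il_i=p_0n$, is sent to $(p_1,\dots,p_k)-p_0(1,\dots,1)$.)
   Context: $L$ is generic if for all $I,J\subseteq[k]$, $\sum_{i\in I}l_i=\sum_{j\in J}l_j$ implies $I=J$; reduced if $\gcd(l_1,\dots,l_k)=1$. The generalized tonnetz $Tonn^{n,k}(L)$ is the simplicial complex on vertex set $\mathbb{Z}_n$ whose maximal simplices are $\Delta(x;\sigma)=\{x,\,x+l_{\sigma(1)},\dots,x+l_{\sigma(1)}+\dots+l_{\sigma(k-1)}\}$ for $x\in\mathbb{Z}_n$, $\sigma\in S_k$. A step of type $i$ from a vertex $y$ is the oriented 1-simplex from $y$ to $y+l_i$. *)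

theory Defs
  imports "HOL-Algebra.Algebra" "HOL-Combinatorics.Permutations"
begin

text \<open>Conventions. The vertex set Z_n is represented by the naturals 0..n-1, addition mod n.
  The tuple L = (l_1,...,l_k) is represented by a function l on the indices 0..k-1.\<close>

definition generic :: "nat \<Rightarrow> (nat \<Rightarrow> nat) \<Rightarrow> bool" where
  "generic k l \<longleftrightarrow> (\<forall>I J. I \<subseteq> {..<k} \<longrightarrow> J \<subseteq> {..<k} \<longrightarrow> sum l I = sum l J \<longrightarrow> I = J)"

definition reduced :: "nat \<Rightarrow> (nat \<Rightarrow> nat) \<Rightarrow> bool" where
  "reduced k l \<longleftrightarrow> Gcd (l ` {..<k}) = 1"

definition tonn_max :: "nat \<Rightarrow> nat \<Rightarrow> (nat \<Rightarrow> nat) \<Rightarrow> nat set set" where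
  "tonn_max n k l = {(\<lambda>m. (x + (\<Sum>j<m. l (\<sigma> j))) mod n) ` {..<k} | x \<sigma>. x < n \<and> \<sigma> permutes {..<k}}"

definition tonn_simplices :: "nat \<Rightarrow> nat \<Rightarrow> (nat \<Rightarrow> nat) \<Rightarrow> nat set set" where
  "tonn_simplices n k l = {s. s \<noteq> {} \<and> (\<exists>M \<in> tonn_max n k l. s \<subseteq> M)}"

definition tonn_qsimp :: "nat \<Rightarrow> nat \<Rightarrow> (nat \<Rightarrow> nat) \<Rightarrow> nat \<Rightarrow> nat set set" where
  "tonn_qsimp n k l q = {s \<in> tonn_simplices n k l. card s = Suc q}"

text \<open>Simplicial chain group C_q (integer coefficients), simplices oriented by the
  natural order of the vertex labels.\<close>
definition chain_group :: "nat \<Rightarrow> nat \<Rightarrow> (nat \<Rightarrow> nat) \<Rightarrow> nat \<Rightarrow> (nat set \<Rightarrow> int) monoid" where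
  "chain_group n k l q = \<lparr>carrier = {c. \<forall>s. c s \<noteq> 0 \<longrightarrow> s \<in> tonn_qsimp n k l q},
                          monoid.mult = (\<lambda>a b s. a s + b s), monoid.one = (\<lambda>_. 0)\<rparr>"

definition incid :: "nat set \<Rightarrow> nat set \<Rightarrow> int" where
  "incid s t = (if t \<subseteq> s \<and> card (s - t) = 1
                then (-1) ^ card {v \<in> t. v < the_elem (s - t)} else 0)"

definition bd :: "nat \<Rightarrow> nat \<Rightarrow> (nat \<Rightarrow> nat) \<Rightarrow> nat \<Rightarrow> (nat set \<Rightarrow> int) \<Rightarrow> (nat set \<Rightarrow> int)" where
  "bd n k l q c = (\<lambda>t. if t \<in> tonn_qsimp n k l q
                        then (\<Sum>s \<in> tonn_qsimp n k l (Suc q). c s * incid s t) else 0)"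

definition cycles1 :: "nat \<Rightarrow> nat \<Rightarrow> (nat \<Rightarrow> nat) \<Rightarrow> (nat set \<Rightarrow> int) set" where
  "cycles1 n k l = {c \<in> carrier (chain_group n k l 1). bd n k l 0 c = (\<lambda>_. 0)}"

definition boundaries1 :: "nat \<Rightarrow> nat \<Rightarrow> (nat \<Rightarrow> nat) \<Rightarrow> (nat set \<Rightarrow> int) set" where
  "boundaries1 n k l = bd n k l 1 ` carrier (chain_group n k l 2)"

definition H1_tonn :: "nat \<Rightarrow> nat \<Rightarrow> (nat \<Rightarrow> nat) \<Rightarrow> (nat set \<Rightarrow> int) set monoid" where
  "H1_tonn n k l = (chain_group n k l 1)\<lparr>carrier := cycles1 n k l\<rparr> Mod boundaries1 n k l"

definition lattice_HL :: "nat \<Rightarrow> (nat \<Rightarrow> nat) \<Rightarrow> (nat \<Rightarrow> int) monoid" where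
  "lattice_HL k l = \<lparr>carrier = {x. (\<forall>i. k \<le> i \<longrightarrow> x i = 0) \<and> (\<Sum>i<k. x i * int (l i)) = 0},
                     monoid.mult = (\<lambda>a b i. a i + b i), monoid.one = (\<lambda>_. 0)\<rparr>"

definition edge_chain :: "nat \<Rightarrow> nat \<Rightarrow> nat set \<Rightarrow> int" where
  "edge_chain a b = (\<lambda>s. if a \<noteq> b \<and> s = {a, b} then (if a < b then 1 else -1) else 0)"

text \<open>The path starting at y whose m-th step has type ts!m (types are indices < k).\<close>
definition path_vertex :: "nat \<Rightarrow> (nat \<Rightarrow> nat) \<Rightarrow> nat \<Rightarrow> nat list \<Rightarrow> nat \<Rightarrow> nat" where
  "path_vertex n l y ts m = (y + (\<Sum>j<m. l (ts ! j))) mod n"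

definition path_chain :: "nat \<Rightarrow> (nat \<Rightarrow> nat) \<Rightarrow> nat \<Rightarrow> nat list \<Rightarrow> nat set \<Rightarrow> int" where
  "path_chain n l y ts = (\<lambda>s. \<Sum>m<length ts.
      edge_chain (path_vertex n l y ts m) (path_vertex n l y ts (Suc m)) s)"

end

theory Submission
  imports Defs "HOL-Library.Function_Algebras"
begin

text \<open>
  By genericity an edge of vertices \<open>a < b\<close> determines the set of types \<open>I\<close> whose lengths
  add up to \<open>b - a\<close>. Sending the edge to the indicator vector of \<open>I\<close> defines a 1-cochain with
  values in \<open>\<int>\<^sup>k\<close>, the \<open>winding\<close>. On an edge from \<open>y\<close> to \<open>y + l\<^sub>I\<close> its value is the indicator of \<open>I\<close>
  minus the number of times the edge passes 0. It has a potential on every simplex, so it is a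
  cocycle; its pairing with \<open>L\<close> is the coboundary of the vertex label, so cycles have windings
  in the lattice.

  Conversely, the triangles make any two steps commute and make \<open>k\<close> steps of distinct types
  null-homologous. Hence the class of a path depends only on its start and on the multiset of its
  types, and it vanishes when all types occur equally often. Since \<open>L\<close> is reduced, every vertex is
  reachable from 0, so every cycle is homologous to a single closed path at 0. If the winding of
  that path is zero, then all types occur equally often.
\<close>

section \<open>Auxiliary facts on sums, quotients, Bezout coefficients and lists\<close>

lemma sum_fun_apply: "(\<Sum>x\<in>A. f x) s = (\<Sum>x\<in>A. f x s)"
  for f :: "'a \<Rightarrow> 'b \<Rightarrow> 'c::comm_monoid_add"
  by (induction A rule: infinite_finite_induct) auto

lemma edge_chain_same [simp]: "edge_chain a a = 0"
  by (auto simp: edge_chain_def)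

lemma edge_chain_swap: "edge_chain b a = - edge_chain a b"
  by (auto simp: edge_chain_def fun_eq_iff)

text \<open>Passages through 0 will be counted by \<open>div n\<close>. This carry rule adds the
  counts of two consecutive pieces of a path, the second one starting at the reduced label.\<close>

lemma div_add_mod: "(a + b) div n = a div n + (a mod n + b) div n" for a b n :: nat
proof (cases "n = 0")
  case False
  have "(a + b) div n = ((a mod n + b) + n * (a div n)) div n" by simp
  also have "\<dots> = a div n + (a mod n + b) div n" using False by (subst div_mult_self2) auto
  finally show ?thesis .
qed simp

lemma Gcd_bezout: "\<exists>x :: nat \<Rightarrow> int. (\<Sum>i<m. x i * int (l i)) = int (Gcd (l ` {..<m}))"
proof (induction m)
  case (Suc m)
  then obtain x where x: "(\<Sum>i<m. x i * int (l i)) = int (Gcd (l ` {..<m}))" by blast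
  obtain u v where uv: "u * int (l m) + v * int (Gcd (l ` {..<m})) = gcd (int (l m)) (int (Gcd (l ` {..<m})))"
    using bezout_int by blast
  define x' where "x' i = (if i = m then u else v * x i)" for i
  have "(\<Sum>i<m. x' i * int (l i)) = v * (\<Sum>i<m. x i * int (l i))"
    unfolding sum_distrib_left by (rule sum.cong) (auto simp: x'_def)
  then have "(\<Sum>i<Suc m. x' i * int (l i)) = int (Gcd (l ` {..<Suc m}))"
    using x uv by (simp add: x'_def lessThan_Suc)
  then show ?case by blast
qed simp

text \<open>Turns prescribed multiplicities into a path; by commutativity up to homology the order
  of the steps will not matter.\<close>

lemma list_of_counts:
  fixes p :: "nat \<Rightarrow> nat"
  obtains ts where "set ts \<subseteq> {..<k}" "\<And>i. i < k \<Longrightarrow> count (mset ts) i = p i"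
proof -
  have "count (mset (concat (map (\<lambda>i. replicate (p i) i) [0..<m]))) i = (if i < m then p i else 0)" for m i
    by (induction m) (auto simp: less_Suc_eq)
  moreover have "set (concat (map (\<lambda>i. replicate (p i) i) [0..<k])) \<subseteq> {..<k}" by auto
  ultimately show thesis by (intro that[of "concat (map (\<lambda>i. replicate (p i) i) [0..<k])"]) simp_all
qed

lemma sum_list_count_mset:
  fixes l :: "nat \<Rightarrow> nat"
  assumes "set ts \<subseteq> {..<k}"
  shows "sum_list (map l ts) = (\<Sum>i<k. count (mset ts) i * l i)"
  using assms
proof (induction ts)
  case (Cons t ts)
  have "(\<Sum>i<k. count (mset (t # ts)) i * l i) = (\<Sum>i<k. count (mset ts) i * l i + (if i = t then l i else 0))"
    by (rule sum.cong) auto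
  also have "\<dots> = (\<Sum>i<k. count (mset ts) i * l i) + l t"
    using Cons.prems unfolding sum.distrib by (subst sum.delta) auto
  finally show ?case using Cons by simp
qed simp

section \<open>Simplices of the tonnetz\<close>

locale tonnetz =
  fixes k n :: nat and l :: "nat \<Rightarrow> nat"
  assumes k2: "2 \<le> k" and l_pos: "\<And>i. i < k \<Longrightarrow> 0 < l i"
    and generic: "generic k l" and reduced: "reduced k l"
    and n_eq: "n = (\<Sum>i<k. l i)"
begin

abbreviation Q where "Q \<equiv> tonn_qsimp n k l"
abbreviation B where "B \<equiv> boundaries1 n k l"

text \<open>The vertex reached from \<open>a\<close> by one step of each type in \<open>I\<close>.
  Describing vertices of a simplex by sets of types replaces the permutations by chains of
  subsets.\<close>

definition shift :: "nat \<Rightarrow> nat set \<Rightarrow> nat" where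
  "shift a I = (a + sum l I) mod n"

lemma empty_psubset: "{} \<subset> {..<k}"
proof -
  have "0 \<in> {..<k}" using k2 by simp
  then show ?thesis by blast
qed

lemma sum_le_n: "I \<subseteq> {..<k} \<Longrightarrow> sum l I \<le> n"
  unfolding n_eq by (rule sum_mono2) auto

lemma sum_less_n: "I \<subset> {..<k} \<Longrightarrow> sum l I < n"
proof -
  assume I: "I \<subset> {..<k}"
  then obtain i where "i \<in> {..<k} - I" by blast
  then show "sum l I < n"
    unfolding n_eq using I l_pos by (intro sum_strict_mono2[of _ _ i]) auto
qed

lemma sum_pos: "I \<subseteq> {..<k} \<Longrightarrow> I \<noteq> {} \<Longrightarrow> 0 < sum l I"
  by (rule Groups_Big.sum_pos) (use l_pos in \<open>blast intro: finite_subset\<close>)+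

lemma n_pos: "0 < n"
  using sum_pos[of "{..<k}"] k2 by (auto simp: n_eq lessThan_empty_iff)

lemma sum_full: "sum l {..<k} = n"
  by (simp add: n_eq)

lemma shift_less [simp]: "shift a I < n"
  using n_pos by (simp add: shift_def)

lemma shift_empty [simp]: "a < n \<Longrightarrow> shift a {} = a"
  by (simp add: shift_def)

lemma shift_full [simp]: "a < n \<Longrightarrow> shift a {..<k} = a"
  by (simp add: shift_def sum_full)

lemma shift_shift:
  assumes "I \<inter> J = {}" "I \<subseteq> {..<k}" "J \<subseteq> {..<k}"
  shows "shift (shift a I) J = shift a (I \<union> J)"
proof -
  have "sum l (I \<union> J) = sum l I + sum l J"
    using assms by (intro sum.union_disjoint) (auto intro: finite_subset)
  then show ?thesis by (simp add: shift_def mod_add_left_eq add.assoc)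
qed

lemma shift_diff:
  assumes "I \<subseteq> J" "J \<subseteq> {..<k}"
  shows "shift (shift a I) (J - I) = shift a J"
  using shift_shift[of I "J - I" a] assms by (auto simp: Un_absorb1)

text \<open>Genericity enters here. The subsets must be proper because \<open>{}\<close> and
  \<open>{..<k}\<close> both lead back to \<open>a\<close>.\<close>

lemma shift_inj:
  assumes "I \<subset> {..<k}" "J \<subset> {..<k}" "shift a I = shift a J"
  shows "I = J"
proof -
  have "sum l I = sum l J"
  proof (rule ccontr)
    \<comment> \<open>Distinct sums below \<open>n\<close> stay distinct modulo
      \<open>n\<close>.\<close>
    have *: "False" if "i < j" "j < n" "(a + i) mod n = (a + j) mod n" for i j
    proof -
      have "n dvd (a + j) - (a + i)" using that mod_eq_dvd_iff_nat[of "a+i" "a+j" n] by simp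
      then show False using that by (auto dest!: dvd_imp_le)
    qed
    assume "sum l I \<noteq> sum l J"
    then show False
      using *[of "sum l I" "sum l J"] *[of "sum l J" "sum l I"] assms sum_less_n
      by (auto simp: shift_def neq_iff)
  qed
  then show ?thesis using generic assms unfolding generic_def by blast
qed

text \<open>A permutation that lists \<open>I\<close> first, then \<open>J - I\<close>, then the
  other types has the sums of \<open>I\<close> and \<open>J\<close> among its partial sums. Since
  \<open>J\<close> is proper, \<open>card J\<close> is a legal index, the largest one being
  k-1.\<close>

lemma flag_simplex:
  assumes y: "y < n" and I: "I \<subseteq> J" and J: "J \<subset> {..<k}"
  shows "{y, shift y I, shift y J} \<in> tonn_simplices n k l"
proof -
  have fin: "finite J" "finite I"
    using J I by (meson finite_lessThan finite_subset psubset_imp_subset)+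
  define xs where
    "xs = sorted_list_of_set I @ sorted_list_of_set (J - I) @ sorted_list_of_set ({..<k} - J)"
  have set_xs: "set xs = {..<k}" and dist: "distinct xs"
    using I psubset_imp_subset[OF J] fin by (auto simp: xs_def)
  have len: "length xs = k"
    using distinct_card[OF dist] by (simp only: set_xs card_lessThan)
  define \<sigma> where "\<sigma> j = (if j < k then xs ! j else j)" for j
  have "bij_betw ((!) xs) {..<k} {..<k}"
    by (rule bij_betw_nth[OF dist]) (simp_all only: len set_xs)
  then have "bij_betw \<sigma> {..<k} {..<k}"
    using bij_betw_cong[of "{..<k}" \<sigma> "(!) xs" "{..<k}"] by (simp add: \<sigma>_def)
  then have perm: "\<sigma> permutes {..<k}"
    by (rule bij_imp_permutes) (simp add: \<sigma>_def)
  have part: "(\<Sum>j<m. l (\<sigma> j)) = sum l (set (take m xs))" if "m \<le> k" for m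
  proof -
    have "\<sigma> ` {..<m} = (!) xs ` {0..<m}"
      using that by (force simp: \<sigma>_def image_iff)
    also have "\<dots> = set (take m xs)"
      using that len by (simp add: nth_image)
    finally show ?thesis
      using sum.reindex[of \<sigma> "{..<m}" l] permutes_inj_on[OF perm] by simp
  qed
  let ?M = "(\<lambda>m. (y + (\<Sum>j<m. l (\<sigma> j))) mod n) ` {..<k}"
  have cJ: "card J < k" using psubset_card_mono[OF _ J] by simp
  have cI: "card I \<le> card J" using I fin by (simp add: card_mono)
  have "set (take (card I) xs) = I" using fin by (simp add: xs_def)
  moreover have "set (take (card J) xs) = J"
    using fin I cI by (auto simp: xs_def card_Diff_subset)
  ultimately have "shift y I = (y + (\<Sum>j<card I. l (\<sigma> j))) mod n"
      "shift y J = (y + (\<Sum>j<card J. l (\<sigma> j))) mod n"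
    using part[of "card I"] part[of "card J"] cI cJ by (simp_all add: shift_def)
  then have "shift y I \<in> ?M" "shift y J \<in> ?M"
    using cI cJ by auto
  moreover have "y \<in> ?M"
    using y k2 by (auto intro!: image_eqI[of _ _ 0])
  moreover have "?M \<in> tonn_max n k l"
    using perm y unfolding tonn_max_def by blast
  ultimately show ?thesis
    unfolding tonn_simplices_def mem_Collect_eq by (metis insert_not_empty insert_subset empty_subsetI)
qed

text \<open>Partial sums along a permutation are sums over images of initial segments, and these
  images form a chain. The base point \<open>x\<close> need not belong to \<open>s\<close>.\<close>

lemma simplex_flag:
  assumes "s \<in> tonn_simplices n k l"
  obtains x U where "\<And>a. a \<in> s \<Longrightarrow> U a \<subseteq> {..<k} \<and> a = shift x (U a)"
    "\<And>a b. a \<in> s \<Longrightarrow> b \<in> s \<Longrightarrow> U a \<subseteq> U b \<or> U b \<subseteq> U a"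
proof -
  obtain x \<sigma> where x: "x < n" and \<sigma>: "\<sigma> permutes {..<k}"
    and s: "s \<subseteq> (\<lambda>m. (x + (\<Sum>j<m. l (\<sigma> j))) mod n) ` {..<k}"
    using assms unfolding tonn_simplices_def tonn_max_def by blast
  then have "\<forall>a\<in>s. \<exists>m<k. a = (x + (\<Sum>j<m. l (\<sigma> j))) mod n" by blast
  then obtain m where m: "\<And>a. a \<in> s \<Longrightarrow> m a < k \<and> a = (x + (\<Sum>j<m a. l (\<sigma> j))) mod n"
    by metis
  have sh: "sum l (\<sigma> ` {..<i}) = (\<Sum>j<i. l (\<sigma> j))" for i
    using sum.reindex[of \<sigma> "{..<i}" l] permutes_inj_on[OF \<sigma>] by simp
  have "\<sigma> ` {..<i} \<subseteq> {..<k}" if "i < k" for i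
    using permutes_image[OF \<sigma>] that by (metis image_mono less_imp_le lessThan_subset_iff)
  then have sub: "\<sigma> ` {..<m a} \<subseteq> {..<k} \<and> a = shift x (\<sigma> ` {..<m a})" if "a \<in> s" for a
    using m[OF that] by (simp add: shift_def sh)
  have "\<sigma> ` {..<i} \<subseteq> \<sigma> ` {..<j} \<or> \<sigma> ` {..<j} \<subseteq> \<sigma> ` {..<i}" for i j
    by (cases "i \<le> j") (auto intro!: image_mono)
  with sub show thesis
    by (intro that[of "\<lambda>a. \<sigma> ` {..<m a}" x])
qed

lemma simplex_less: "s \<in> tonn_simplices n k l \<Longrightarrow> a \<in> s \<Longrightarrow> a < n"
  using simplex_flag shift_less by metis

lemma simplex_shift:
  assumes "s \<in> tonn_simplices n k l" "a \<in> s" "b \<in> s"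
  shows "\<exists>I\<subseteq>{..<k}. b = shift a I"
proof -
  obtain x U where U: "\<And>a. a \<in> s \<Longrightarrow> U a \<subseteq> {..<k} \<and> a = shift x (U a)"
    "\<And>a b. a \<in> s \<Longrightarrow> b \<in> s \<Longrightarrow> U a \<subseteq> U b \<or> U b \<subseteq> U a"
    using simplex_flag[OF assms(1)] by metis
  have a: "U a \<subseteq> {..<k}" "a = shift x (U a)" and b: "U b \<subseteq> {..<k}" "b = shift x (U b)"
    using U assms by auto
  consider "U a \<subseteq> U b" | "U b \<subseteq> U a" using U assms by blast
  then show ?thesis
  proof cases
    case 1
    then have "shift a (U b - U a) = b"
      using shift_diff[of "U a" "U b" x] a b by metis
    moreover have "U b - U a \<subseteq> {..<k}" using b(1) by blast
    ultimately show ?thesis by metis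
  next
    case 2
    then have "shift b (U a - U b) = a"
      using shift_diff[of "U b" "U a" x] a b by metis
    \<comment> \<open>From \<open>b\<close> the types in \<open>U a - U b\<close> lead to
      \<open>a\<close>; the remaining types complete a full round and so lead from \<open>a\<close>
      back to \<open>b\<close>.\<close>
    then have "shift a ({..<k} - (U a - U b)) = shift b {..<k}"
      using shift_diff[of "U a - U b" "{..<k}" b] a(1) by (metis Diff_subset order.refl subset_trans)
    also have "\<dots> = b" using b(2) by (metis shift_full shift_less)
    finally show ?thesis by (metis Diff_subset)
  qed
qed

lemma finite_Q: "finite (Q q)"
proof (rule finite_subset)
  show "Q q \<subseteq> Pow {..<n}" using simplex_less by (auto simp: tonn_qsimp_def)
qed simp

lemma Q_subset: "t \<in> Q q \<Longrightarrow> s \<subseteq> t \<Longrightarrow> card s = Suc r \<Longrightarrow> s \<in> Q r"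
  unfolding tonn_qsimp_def tonn_simplices_def mem_Collect_eq
  by (metis card.empty nat.distinct(1) subset_trans)

lemma Q0_iff: "s \<in> Q 0 \<longleftrightarrow> (\<exists>v<n. s = {v})"
proof
  assume "s \<in> Q 0"
  then show "\<exists>v<n. s = {v}"
    using simplex_less by (auto simp: tonn_qsimp_def card_1_singleton_iff)
next
  assume "\<exists>v<n. s = {v}"
  then obtain v where "v < n" "s = {v}" by blast
  then show "s \<in> Q 0"
    using flag_simplex[of v "{}" "{}"] empty_psubset by (auto simp: tonn_qsimp_def)
qed

lemma Q1E:
  assumes "e \<in> Q 1"
  obtains a b where "a < b" "b < n" "e = {a, b}"
proof -
  have "card e = 2" using assms by (simp add: tonn_qsimp_def)
  then obtain a b where ab: "e = {a, b}" "a \<noteq> b"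
    by (auto simp: card_2_iff)
  have "a < n" "b < n"
    using assms simplex_less ab by (auto simp: tonn_qsimp_def)
  with ab show thesis
    by (metis insert_commute nat_neq_iff that)
qed

text \<open>The order of the endpoints removes the reduction modulo \<open>n\<close>: a sum that
  wrapped around would give a label at most \<open>a\<close>, as \<open>sum l I\<close> is at most
  \<open>n\<close>.\<close>

lemma Q1_shift:
  assumes "{a, b} \<in> Q 1" "a < b"
  obtains I where "I \<subseteq> {..<k}" "b = a + sum l I" "b = shift a I"
proof -
  obtain I where I: "I \<subseteq> {..<k}" "b = shift a I"
    using simplex_shift[of "{a,b}" a b] assms by (auto simp: tonn_qsimp_def)
  have a: "a < n" using simplex_less assms by (auto simp: tonn_qsimp_def)
  have "b = a + sum l I"
  proof (cases "a + sum l I < n")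
    case False
    then have "b = a + sum l I - n"
      using I a sum_le_n[OF I(1)] n_pos by (simp add: shift_def le_mod_geq)
    then show ?thesis using assms(2) sum_le_n[OF I(1)] by linarith
  qed (use I in \<open>simp add: shift_def\<close>)
  with I that show thesis by blast
qed

lemma shift_neq:
  assumes "a < n" "I \<subset> {..<k}" "I \<noteq> {}"
  shows "shift a I \<noteq> a"
  using shift_inj[of I "{}" a] assms by auto

lemma Q1_shiftI:
  assumes "a < n" "I \<subset> {..<k}" "I \<noteq> {}"
  shows "{a, shift a I} \<in> Q 1"
  using flag_simplex[of a I I] assms shift_neq[OF assms] by (auto simp: tonn_qsimp_def)

lemma Q2_shiftI:
  assumes "a < n" "I \<subset> J" "J \<subset> {..<k}" "I \<noteq> {}"
  shows "{a, shift a I, shift a J} \<in> Q 2"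
proof -
  have "I \<subset> {..<k}" "J \<noteq> {}" using assms by auto
  then have "shift a I \<noteq> a" "shift a J \<noteq> a" "shift a I \<noteq> shift a J"
    using assms shift_neq[of a I] shift_neq[of a J] shift_inj[of I J a] by auto
  then show ?thesis
    using flag_simplex[of a I J] assms by (simp add: tonn_qsimp_def psubset_imp_subset)
qed

lemma Q2E:
  assumes "t \<in> Q 2"
  obtains a b c where "a < b" "b < c" "t = {a, b, c}"
proof -
  have "card t = 3" using assms by (simp add: tonn_qsimp_def)
  then obtain a b c where "t = {a, b, c}" "a \<noteq> b" "b \<noteq> c" "a \<noteq> c"
    by (auto simp: card_3_iff)
  moreover have "{a,b,c} = {b,a,c}" "{a,b,c} = {a,c,b}" "{a,b,c} = {b,c,a}" "{a,b,c} = {c,a,b}" "{a,b,c} = {c,b,a}"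
    by auto
  ultimately show thesis using that by (metis nat_neq_iff)
qed

section \<open>Boundaries of triangles\<close>

lemma carrier_chain_group: "c \<in> carrier (chain_group n k l q) \<longleftrightarrow> (\<forall>s. s \<notin> Q q \<longrightarrow> c s = 0)"
  by (auto simp: chain_group_def)

text \<open>Writes a boundary as a linear combination of boundaries of single simplices, the form
  needed for arguments by linearity.\<close>

lemma bd_eq:
  "bd n k l q c = (\<Sum>t\<in>Q (Suc q). (\<lambda>s. c t * (if s \<in> Q q then incid t s else 0)))"
  by (auto simp: bd_def sum_fun_apply fun_eq_iff)

lemma bd_add: "bd n k l q (c + d) = bd n k l q c + bd n k l q d"
  by (auto simp: bd_def fun_eq_iff distrib_right sum.distrib)

lemma bd_diff: "bd n k l q (c - d) = bd n k l q c - bd n k l q d"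
  by (auto simp: bd_def fun_eq_iff left_diff_distrib sum_subtractf)

lemma bd_smult: "bd n k l q (\<lambda>s. z * c s) = (\<lambda>s. z * bd n k l q c s)"
  by (auto simp: bd_def fun_eq_iff sum_distrib_left mult.assoc)

lemma bd_zero [simp]: "bd n k l q 0 = 0"
  by (auto simp: bd_def fun_eq_iff)

lemma bd_sum: "bd n k l q (\<Sum>x\<in>A. f x) = (\<Sum>x\<in>A. bd n k l q (f x))"
  by (induction A rule: infinite_finite_induct)
    (simp_all only: sum.infinite sum.empty sum.insert bd_zero bd_add not_False_eq_True)

section \<open>The subgroup of boundaries and the homology relation\<close>

lemma boundaries1_zero: "0 \<in> B"
  unfolding boundaries1_def by (rule image_eqI[of _ _ 0]) (auto simp: carrier_chain_group)

lemma boundaries1_diff: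
  assumes "c \<in> B" "d \<in> B"
  shows "c - d \<in> B"
proof -
  obtain c' d' where "c = bd n k l 1 c'" "d = bd n k l 1 d'"
    and "c' \<in> carrier (chain_group n k l 2)" "d' \<in> carrier (chain_group n k l 2)"
    using assms unfolding boundaries1_def by blast
  then have "c - d = bd n k l 1 (c' - d')" "c' - d' \<in> carrier (chain_group n k l 2)"
    by (simp_all add: bd_diff carrier_chain_group)
  then show ?thesis unfolding boundaries1_def by (rule image_eqI)
qed

lemma boundaries1_uminus: "c \<in> B \<Longrightarrow> - c \<in> B"
  using boundaries1_diff[OF boundaries1_zero] by simp

lemma boundaries1_add: "c \<in> B \<Longrightarrow> d \<in> B \<Longrightarrow> c + d \<in> B"
  using boundaries1_diff[OF _ boundaries1_uminus, of c d] by simp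

text \<open>Not restricted to cycles, so that open paths can be compared too.\<close>

definition homologous :: "(nat set \<Rightarrow> int) \<Rightarrow> (nat set \<Rightarrow> int) \<Rightarrow> bool" (infix "\<approx>\<^sub>h" 50) where
  "c \<approx>\<^sub>h d \<longleftrightarrow> c - d \<in> B"

lemma homologous_refl [simp]: "c \<approx>\<^sub>h c"
  by (simp add: homologous_def boundaries1_zero)

lemma homologous_sym: "c \<approx>\<^sub>h d \<Longrightarrow> d \<approx>\<^sub>h c"
  using boundaries1_uminus[of "c - d"] by (simp add: homologous_def)

lemma homologous_trans [trans]: "c \<approx>\<^sub>h d \<Longrightarrow> d \<approx>\<^sub>h e \<Longrightarrow> c \<approx>\<^sub>h e"
  using boundaries1_add[of "c - d" "d - e"] by (simp add: homologous_def)

text \<open>The generic substitution rules make calculations diverge on chains, which are functions: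
  their higher-order unification problem has too many solutions. Hence the two special cases.\<close>

lemma eq_homologous_trans [trans]: "c = d \<Longrightarrow> d \<approx>\<^sub>h e \<Longrightarrow> c \<approx>\<^sub>h e"
  by simp

lemma homologous_eq_trans [trans]: "c \<approx>\<^sub>h d \<Longrightarrow> d = e \<Longrightarrow> c \<approx>\<^sub>h e"
  by simp

lemma homologous_add: "c \<approx>\<^sub>h c' \<Longrightarrow> d \<approx>\<^sub>h d' \<Longrightarrow> c + d \<approx>\<^sub>h c' + d'"
  using boundaries1_add[of "c - c'" "d - d'"] by (simp add: homologous_def algebra_simps)

lemma homologous_diff: "c \<approx>\<^sub>h c' \<Longrightarrow> d \<approx>\<^sub>h d' \<Longrightarrow> c - d \<approx>\<^sub>h c' - d'"
  using boundaries1_diff[of "c - c'" "d - d'"] by (simp add: homologous_def algebra_simps)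

lemma incid_pair:
  assumes "a < b"
  shows "incid {a, b} {v} = (if v = b then 1 else if v = a then - 1 else 0)"
proof -
  have d: "{a, b} - {b} = {a}" "{a, b} - {a} = {b}" using assms by auto
  have c: "{w \<in> {b}. w < a} = {}" "{w \<in> {a}. w < b} = {a}" using assms by auto
  consider "v = b" | "v = a" "v \<noteq> b" | "v \<notin> {a, b}" by blast
  then show ?thesis
  proof cases
    case 1
    then show ?thesis unfolding incid_def 1 d the_elem_eq c by simp
  next
    case 2
    then show ?thesis unfolding incid_def 2(1) d the_elem_eq c using assms by simp
  qed (simp add: incid_def)
qed

text \<open>The signs coming from the vertex order amount to the cyclic orientation of the triangle;
  the edge from \<open>c\<close> back to \<open>a\<close> runs against the order and contributes the
  minus sign.\<close>

lemma incid_triple: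
  assumes "a < b" "b < c" "card s = 2"
  shows "incid {a, b, c} s = (edge_chain a b + edge_chain b c + edge_chain c a) s"
proof (cases "s \<subseteq> {a, b, c}")
  case False
  then have "s \<noteq> {a, b}" "s \<noteq> {b, c}" "s \<noteq> {c, a}" by auto
  then show ?thesis using False by (simp only: incid_def edge_chain_def plus_fun_apply) simp
next
  case True
  obtain x y where "s = {x, y}" "x \<noteq> y" using assms(3) by (auto simp: card_2_iff)
  with True consider "s = {a, b}" | "s = {b, c}" | "s = {a, c}" by auto
  then show ?thesis
  proof cases
    case 1
    have "{a, b, c} - {a, b} = {c}" "{v \<in> {a, b}. v < c} = {a, b}" using assms by auto
    note eq = this
    show ?thesis unfolding incid_def 1 eq(1) the_elem_eq eq(2) using assms by (simp add: edge_chain_def doubleton_eq_iff)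
  next
    case 2
    have "{a, b, c} - {b, c} = {a}" "{v \<in> {b, c}. v < a} = {}" using assms by auto
    note eq = this
    show ?thesis unfolding incid_def 2 eq(1) the_elem_eq eq(2) using assms by (simp add: edge_chain_def doubleton_eq_iff)
  next
    case 3
    have "{a, b, c} - {a, c} = {b}" "{v \<in> {a, c}. v < b} = {a}" using assms by auto
    note eq = this
    show ?thesis unfolding incid_def 3 eq(1) the_elem_eq eq(2) using assms by (simp add: edge_chain_def doubleton_eq_iff)
  qed
qed

lemma Q_triangle_faces:
  assumes "{a, b, c} \<in> Q 2" "a \<noteq> b" "b \<noteq> c" "a \<noteq> c"
  shows "{a, b} \<in> Q 1" "{b, c} \<in> Q 1" "{a, c} \<in> Q 1"
  using assms by (auto intro!: Q_subset[OF assms(1)])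

lemma incid_triangle:
  assumes "{a, b, c} \<in> Q 2" "a < b" "b < c"
  shows "(\<lambda>s. if s \<in> Q 1 then incid {a, b, c} s else 0)
    = edge_chain a b + edge_chain b c + edge_chain c a"
proof
  fix s
  show "(if s \<in> Q 1 then incid {a, b, c} s else 0) = (edge_chain a b + edge_chain b c + edge_chain c a) s"
  proof (cases "s \<in> Q 1")
    case True
    then have "card s = 2" by (simp add: tonn_qsimp_def)
    then show ?thesis using incid_triple assms True by auto
  next
    case False
    then have "s \<noteq> {a, b}" "s \<noteq> {b, c}" "s \<noteq> {c, a}"
      using Q_triangle_faces[OF assms(1)] assms by (auto simp: insert_commute)
    then show ?thesis using False by (simp add: edge_chain_def)
  qed
qed

text \<open>Drops the ordering of the vertices: a rotation keeps the cyclic sum and a reflection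
  negates it, so all six orders reduce to the sorted one.\<close>

lemma triangle_boundary:
  assumes "{a, b, c} \<in> Q 2"
  shows "edge_chain a b + edge_chain b c + edge_chain c a \<in> B"
proof -
  have sorted: "edge_chain a b + edge_chain b c + edge_chain c a \<in> B"
    if t: "{a, b, c} \<in> Q 2" "a < b" "b < c" for a b c
  proof -
    \<comment> \<open>The 2-chain consisting of this one triangle.\<close>
    let ?i = "\<lambda>s. if s = {a, b, c} then 1 else (0::int)"
    have "bd n k l 1 ?i = (\<lambda>s. if s \<in> Q 1 then incid {a, b, c} s else 0)"
    proof
      fix s
      have "(\<Sum>u\<in>Q 2. ?i u * incid u s) = (\<Sum>u\<in>{{a, b, c}}. ?i u * incid u s)"
        using t finite_Q by (intro sum.mono_neutral_right) auto
      then show "bd n k l 1 ?i s = (if s \<in> Q 1 then incid {a, b, c} s else 0)"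
        by (simp add: bd_def numeral_2_eq_2)
    qed
    moreover have "?i \<in> carrier (chain_group n k l 2)"
      using t by (simp add: carrier_chain_group)
    ultimately show ?thesis
      unfolding incid_triangle[OF t, symmetric] boundaries1_def by (rule image_eqI[OF sym])
  qed
  have cyc: "edge_chain a b + edge_chain b c + edge_chain c a
      = edge_chain b c + edge_chain c a + edge_chain a b" for a b c
    by (simp add: algebra_simps)
  have neg: "edge_chain a b + edge_chain b c + edge_chain c a
      = - (edge_chain a c + edge_chain c b + edge_chain b a)" for a b c
    by (simp add: edge_chain_swap[of a c] edge_chain_swap[of c b] edge_chain_swap[of b a])
  have "card {a, b, c} = 3" using assms by (simp add: tonn_qsimp_def)
  then have "a \<noteq> b" "b \<noteq> c" "a \<noteq> c" by (auto simp: card_insert_if split: if_splits)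
  then consider "a < b" "b < c" | "b < c" "c < a" | "c < a" "a < b"
    | "a < c" "c < b" | "c < b" "b < a" | "b < a" "a < c" by linarith
  then show ?thesis
  proof cases
    case 1 then show ?thesis using sorted assms by blast
  next
    case 2 then show ?thesis
      using sorted[of b c a] assms by (simp add: cyc[of a b c] insert_commute)
  next
    case 3 then show ?thesis
      using sorted[of c a b] assms by (simp add: cyc[of c a b] insert_commute)
  next
    case 4 then show ?thesis
      using boundaries1_uminus[OF sorted[of a c b]] assms by (simp add: neg[of a b c] insert_commute)
  next
    case 5 then show ?thesis
      using boundaries1_uminus[OF sorted[of c b a]] assms
      by (simp add: neg[of a b c] cyc[of a c b] insert_commute)
  next
    case 6 then show ?thesis
      using boundaries1_uminus[OF sorted[of b a c]] assms
      by (simp add: neg[of a b c] cyc[of b a c] insert_commute)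
  qed
qed

text \<open>Two sides of a triangle are homologous to the third. When \<open>I \<union> J\<close>
  contains all types there is no triangle, but then the second edge runs back along the first and
  the right-hand side is the zero chain.\<close>

lemma edge_chain_shift:
  assumes "a < n" "I \<inter> J = {}" "I \<subseteq> {..<k}" "J \<subseteq> {..<k}"
  shows "edge_chain a (shift a I) + edge_chain (shift a I) (shift a (I \<union> J))
    \<approx>\<^sub>h edge_chain a (shift a (I \<union> J))"
proof -
  consider "I = {}" | "J = {}" | "I \<union> J = {..<k}" | "I \<noteq> {}" "I \<subset> I \<union> J" "I \<union> J \<subset> {..<k}"
    using assms by blast
  then show ?thesis
  proof cases
    case 3
    then show ?thesis using assms(1) by (simp add: edge_chain_swap[of "shift a I" a])
  next
    case 4
    have "{a, shift a I, shift a (I \<union> J)} \<in> Q 2"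
      using Q2_shiftI[OF assms(1) 4(2,3,1)] .
    from triangle_boundary[OF this] show ?thesis
      by (simp add: homologous_def edge_chain_swap[of "shift a (I \<union> J)" a])
  qed (use assms in simp_all)
qed

section \<open>Edge paths up to homology\<close>

abbreviation P where "P \<equiv> path_chain n l"

text \<open>Written with \<open>sum_list\<close> so that recursion over the list and invariance
  under reordering are immediate.\<close>

definition end_vertex :: "nat \<Rightarrow> nat list \<Rightarrow> nat" where
  "end_vertex y ts = (y + sum_list (map l ts)) mod n"

lemma end_vertex_less [simp]: "end_vertex y ts < n"
  using n_pos by (simp add: end_vertex_def)

lemma end_vertex_Nil [simp]: "y < n \<Longrightarrow> end_vertex y [] = y"
  by (simp add: end_vertex_def)

lemma end_vertex_append: "end_vertex y (ts @ us) = end_vertex (end_vertex y ts) us"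
  by (simp add: end_vertex_def mod_add_left_eq add.assoc)

lemma end_vertex_Cons: "end_vertex y (t # ts) = end_vertex (shift y {t}) ts"
  by (simp add: end_vertex_def shift_def mod_add_left_eq add.assoc)

lemma end_vertex_distinct: "distinct ts \<Longrightarrow> end_vertex y ts = shift y (set ts)"
  by (simp add: end_vertex_def shift_def sum_list_distinct_conv_sum_set)

lemma end_vertex_cong: "mset ts = mset us \<Longrightarrow> end_vertex y ts = end_vertex y us"
  by (metis end_vertex_def mset_map sum_mset_sum_list)

lemma path_Nil [simp]: "P y [] = 0"
  by (auto simp: path_chain_def)

lemma path_Cons: "y < n \<Longrightarrow> P y (t # ts) = edge_chain y (shift y {t}) + P (shift y {t}) ts"
proof
  fix s
  have v: "path_vertex n l y (t # ts) (Suc m) = path_vertex n l (shift y {t}) ts m" for m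
    by (simp add: path_vertex_def shift_def mod_add_left_eq add.assoc sum.lessThan_Suc_shift
          del: sum.lessThan_Suc)
  assume "y < n"
  then have "path_vertex n l y (t # ts) 0 = y" by (simp add: path_vertex_def)
  moreover have "path_vertex n l (shift y {t}) ts 0 = shift y {t}" by (simp add: path_vertex_def)
  ultimately show "P y (t # ts) s = (edge_chain y (shift y {t}) + P (shift y {t}) ts) s"
    by (simp add: path_chain_def v sum.lessThan_Suc_shift del: sum.lessThan_Suc)
qed

lemma path_append: "y < n \<Longrightarrow> P y (ts @ us) = P y ts + P (end_vertex y ts) us"
  by (induction ts arbitrary: y) (simp_all add: path_Cons end_vertex_Cons add.assoc)

text \<open>Steps of distinct types fuse one after the other into a single edge from
  \<open>y\<close>, which is why the induction appends at the end. If all types occur, this edge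
  degenerates to zero.\<close>

lemma path_distinct:
  assumes "y < n" "distinct ts" "set ts \<subseteq> {..<k}"
  shows "P y ts \<approx>\<^sub>h edge_chain y (shift y (set ts))"
  using assms(2,3)
proof (induction ts rule: rev_induct)
  case Nil
  then show ?case using assms by simp
next
  case (snoc t ts)
  have "P y (ts @ [t]) = P y ts + edge_chain (shift y (set ts)) (shift (shift y (set ts)) {t})"
    using snoc.prems assms(1) by (simp add: path_append path_Cons end_vertex_distinct)
  also have "\<dots> = P y ts + edge_chain (shift y (set ts)) (shift y (set ts \<union> {t}))"
    using snoc.prems by (subst shift_shift) auto
  also have "\<dots> \<approx>\<^sub>h edge_chain y (shift y (set ts)) + edge_chain (shift y (set ts)) (shift y (set ts \<union> {t}))"
    using snoc by (intro homologous_add) auto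
  also have "\<dots> \<approx>\<^sub>h edge_chain y (shift y (set ts \<union> {t}))"
    by (rule edge_chain_shift) (use snoc.prems assms(1) in simp_all)
  finally show ?case by simp
qed

text \<open>Both ways around the parallelogram are homologous to its diagonal, which is zero if k =
  2.\<close>

lemma path_swap:
  assumes "y < n" "i < k" "j < k"
  shows "P y [i, j] \<approx>\<^sub>h P y [j, i]"
proof (cases "i = j")
  case False
  have "P y [i, j] \<approx>\<^sub>h edge_chain y (shift y {i, j})"
    using path_distinct[of y "[i, j]"] assms False by simp
  moreover have "P y [j, i] \<approx>\<^sub>h edge_chain y (shift y {i, j})"
    using path_distinct[of y "[j, i]"] assms False by (simp add: insert_commute)
  ultimately show ?thesis using homologous_sym homologous_trans by blast
qed simp

lemma path_rotate:
  assumes "y < n" "t < k" "set us \<subseteq> {..<k}"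
  shows "P y (us @ [t]) \<approx>\<^sub>h P y (t # us)"
  using assms
proof (induction us arbitrary: y)
  case (Cons u us)
  have "P y ((u # us) @ [t]) = edge_chain y (shift y {u}) + P (shift y {u}) (us @ [t])"
    using Cons.prems by (simp add: path_Cons)
  also have "\<dots> \<approx>\<^sub>h edge_chain y (shift y {u}) + P (shift y {u}) (t # us)"
    using Cons by (intro homologous_add) auto
  also have "\<dots> = P y [u, t] + P (end_vertex y [u, t]) us"
    using Cons.prems by (simp add: path_Cons end_vertex_Cons add.assoc)
  also have "\<dots> \<approx>\<^sub>h P y [t, u] + P (end_vertex y [u, t]) us"
    using Cons.prems by (intro homologous_add path_swap) auto
  \<comment> \<open>Both orders end at the same vertex, so the tail may be attached to
    either.\<close>
  also have "\<dots> = P y [t, u] + P (end_vertex y [t, u]) us"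
    by (simp add: end_vertex_cong[of "[u, t]" "[t, u]"])
  also have "\<dots> = P y (t # u # us)"
    using Cons.prems by (simp add: path_Cons end_vertex_Cons add.assoc)
  finally show ?case .
qed simp

text \<open>Insertion sort: the first type of \<open>ts\<close> is located in \<open>us\<close> and
  rotated to its front, and the remaining lists are compared from the next vertex.\<close>

lemma path_mset:
  assumes "y < n" "mset ts = mset us" "set ts \<subseteq> {..<k}"
  shows "P y ts \<approx>\<^sub>h P y us"
  using assms
proof (induction ts arbitrary: y us)
  case (Cons t ts)
  have "t \<in> set us" using Cons.prems(2) by (metis list.set_intros(1) mset_eq_setD)
  then obtain us1 us2 where us: "us = us1 @ t # us2" by (meson split_list)
  have sub: "set us \<subseteq> {..<k}" using Cons.prems by (metis mset_eq_setD)
  have m: "mset ts = mset (us1 @ us2)" using Cons.prems(2) us by simp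
  have "P y (t # ts) = edge_chain y (shift y {t}) + P (shift y {t}) ts"
    using Cons.prems by (simp add: path_Cons)
  also have "\<dots> \<approx>\<^sub>h edge_chain y (shift y {t}) + P (shift y {t}) (us1 @ us2)"
    using Cons.prems m by (intro homologous_add Cons.IH) auto
  also have "\<dots> = P y (t # us1) + P (end_vertex y (t # us1)) us2"
    using Cons.prems by (simp add: path_Cons path_append end_vertex_Cons add.assoc)
  also have "\<dots> \<approx>\<^sub>h P y (us1 @ [t]) + P (end_vertex y (t # us1)) us2"
    using Cons.prems sub us by (intro homologous_add homologous_sym[OF path_rotate]) auto
  also have "\<dots> = P y (us1 @ [t]) + P (end_vertex y (us1 @ [t])) us2"
    by (simp add: end_vertex_cong[of "us1 @ [t]" "t # us1"])
  also have "\<dots> = P y us"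
    using path_append[of y "us1 @ [t]" us2] Cons.prems us by simp
  finally show ?case .
qed simp

lemma path_balanced:
  assumes "y < n" "set ts \<subseteq> {..<k}" "\<And>i. i < k \<Longrightarrow> count (mset ts) i = p"
  shows "P y ts \<approx>\<^sub>h 0"
proof -
  \<comment> \<open>Reference path of \<open>p\<close> full rounds. Each round is null-homologous,
    since it fuses into an edge from \<open>y\<close> to itself.\<close>
  let ?c = "\<lambda>p. concat (replicate p [0..<k])"
  have count_c: "count (mset (?c p)) i = (if i < k then p else 0)" for p i
    by (induction p) (auto simp: count_mset_0_iff)
  have closed: "P y (?c p) \<approx>\<^sub>h 0" for p
  proof (induction p)
    case (Suc p)
    have e: "end_vertex y [0..<k] = y"
      using assms(1) by (simp add: end_vertex_distinct atLeast0LessThan)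
    have "P y [0..<k] \<approx>\<^sub>h edge_chain y (shift y {..<k})"
      using path_distinct[of y "[0..<k]"] assms(1) by (simp add: atLeast0LessThan)
    then have "P y [0..<k] \<approx>\<^sub>h 0" using assms(1) by simp
    from homologous_add[OF this Suc] show ?case
      using path_append[OF assms(1), of "[0..<k]"]
      by (simp only: e replicate_Suc concat.simps add_0_left)
  qed simp
  have "mset ts = mset (?c p)"
  proof (rule multiset_eqI)
    fix i show "count (mset ts) i = count (mset (?c p)) i"
      using assms(2) assms(3)[of i] by (auto simp: count_c count_mset_0_iff)
  qed
  then have "P y ts \<approx>\<^sub>h P y (?c p)" using path_mset assms by blast
  then show ?thesis using closed homologous_trans by blast
qed

section \<open>The winding cocycle\<close>

text \<open>Genericity makes the set unique. The description denotes something definite only if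
  \<open>d\<close> is a sum of distinct types, as label differences along edges are.\<close>

definition type_set :: "nat \<Rightarrow> nat set" where
  "type_set d = (THE I. I \<subseteq> {..<k} \<and> sum l I = d)"

lemma type_set_sum: "I \<subseteq> {..<k} \<Longrightarrow> type_set (sum l I) = I"
  unfolding type_set_def using generic unfolding generic_def by (intro the_equality) blast+

text \<open>\<open>Max e - Min e\<close> is the label difference along the orientation of
  \<open>e\<close> used in the chain group, so no case distinction about passing 0 is needed here;
  it reappears in the formula for a single edge.\<close>

definition winding :: "(nat set \<Rightarrow> int) \<Rightarrow> nat \<Rightarrow> int" where
  "winding c = (\<lambda>i. \<Sum>e\<in>Q 1. c e * of_bool (i \<in> type_set (Max e - Min e)))"

lemma winding_add: "winding (c + d) = winding c + winding d"
  by (rule ext) (simp add: winding_def distrib_right sum.distrib)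

lemma winding_uminus: "winding (- c) = - winding c"
  by (rule ext) (simp add: winding_def sum_negf)

lemma winding_zero [simp]: "winding 0 = 0"
  by (rule ext) (simp add: winding_def)

lemma winding_smult: "winding (\<lambda>s. z * c s) = (\<lambda>i. z * winding c i)"
  by (rule ext) (simp add: winding_def sum_distrib_left mult.assoc)

lemma winding_sum: "winding (\<Sum>x\<in>A. f x) = (\<Sum>x\<in>A. winding (f x))"
  by (induction A rule: infinite_finite_induct)
    (simp_all only: sum.infinite sum.empty sum.insert winding_zero winding_add not_False_eq_True)

lemma sum_edge_chain:
  assumes "{a, b} \<in> Q 1" "a < b"
  shows "(\<Sum>e\<in>Q 1. edge_chain a b e * g e) = g {a, b}"
proof -
  have "(\<Sum>e\<in>Q 1. edge_chain a b e * g e) = (\<Sum>e\<in>{{a, b}}. edge_chain a b e * g e)"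
    by (rule sum.mono_neutral_right) (use assms finite_Q in \<open>auto simp: edge_chain_def\<close>)
  then show ?thesis using assms(2) by (simp add: edge_chain_def)
qed

lemma winding_edge:
  assumes "{a, b} \<in> Q 1" "a < b"
  shows "winding (edge_chain a b) = (\<lambda>i. of_bool (i \<in> type_set (b - a)))"
  unfolding winding_def sum_edge_chain[OF assms] using assms(2) by simp

text \<open>If the edge passes 0, it is oriented backwards and carries the complement of
  \<open>I\<close>; minus the indicator of the complement is the indicator of \<open>I\<close> minus
  1. The quotient by \<open>n\<close> is that correction, and it also covers the degenerate
  cases.\<close>

lemma winding_shift:
  assumes "y < n" "I \<subseteq> {..<k}"
  shows "winding (edge_chain y (shift y I))
    = (\<lambda>i. if i < k then of_bool (i \<in> I) - int ((y + sum l I) div n) else 0)"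
proof -
  consider "I = {}" | "I = {..<k}" | "I \<noteq> {}" "I \<subset> {..<k}" using assms(2) by blast
  then show ?thesis
  proof cases
    case 1
    then show ?thesis using assms(1) by (auto simp: fun_eq_iff)
  next
    case 2
    have "(y + n) div n = 1" using assms(1) n_pos by simp
    then show ?thesis using assms(1) 2 by (auto simp: fun_eq_iff sum_full)
  next
    case 3
    define b where "b = shift y I"
    have e: "{y, b} \<in> Q 1" unfolding b_def using Q1_shiftI assms(1) 3 by blast
    have s: "0 < sum l I" "sum l I < n" using sum_pos sum_less_n 3 by blast+
    show ?thesis
    proof (cases "y + sum l I < n")
      case True
      then have "b = y + sum l I" by (simp add: b_def shift_def)
      then have "winding (edge_chain y b) = (\<lambda>i. of_bool (i \<in> I))"
        using winding_edge[OF e] s type_set_sum[OF assms(2)] by simp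
      then show ?thesis using True assms(2) by (auto simp: b_def[symmetric] fun_eq_iff)
    next
      case False
      \<comment> \<open>The edge passes 0, hence \<open>b < y\<close>, and its orientation leads
        from \<open>b\<close> to \<open>y\<close> by the complementary types.\<close>
      have b: "b = y + sum l I - n"
        using False s assms(1) by (simp add: b_def shift_def le_mod_geq)
      have dv: "(y + sum l I) div n = 1"
        by (rule div_nat_eqI) (use False s assms(1) in simp_all)
      have "sum l ({..<k} - I) = n - sum l I"
        using sum_diff_nat[of I "{..<k}" l] assms(2) finite_subset[OF assms(2)] sum_full by simp
      then have "y - b = sum l ({..<k} - I)" using b s False by simp
      then have "type_set (y - b) = {..<k} - I"
        using type_set_sum[of "{..<k} - I"] by simp
      moreover have "b < y" using b s False by linarith
      moreover have "{b, y} \<in> Q 1" using e by (simp add: insert_commute)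
      ultimately have "winding (edge_chain b y) = (\<lambda>i. of_bool (i \<in> {..<k} - I))"
        using winding_edge by metis
      then have "winding (edge_chain y b) = - (\<lambda>i. of_bool (i \<in> {..<k} - I))"
        by (metis edge_chain_swap winding_uminus)
      then show ?thesis using dv assms(2) by (auto simp: b_def[symmetric] fun_eq_iff)
    qed
  qed
qed

lemma winding_simplex:
  assumes "t \<in> tonn_simplices n k l"
  obtains F where "\<And>a b. a \<in> t \<Longrightarrow> b \<in> t \<Longrightarrow> winding (edge_chain a b) = F b - F a"
proof -
  obtain x U where U: "\<And>a. a \<in> t \<Longrightarrow> U a \<subseteq> {..<k} \<and> a = shift x (U a)"
    "\<And>a b. a \<in> t \<Longrightarrow> b \<in> t \<Longrightarrow> U a \<subseteq> U b \<or> U b \<subseteq> U a"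
    using simplex_flag[OF assms(1)] by metis
  \<comment> \<open>The potential at \<open>a\<close> is the edge formula for going from the base
    point \<open>x\<close> to \<open>a\<close> by the types in \<open>U a\<close>.\<close>
  define F where "F a = (\<lambda>i. if i < k then of_bool (i \<in> U a) - int ((x + sum l (U a)) div n) else 0)" for a
  have up: "winding (edge_chain a b) = F b - F a" if "a \<in> t" "b \<in> t" "U a \<subseteq> U b" for a b
  proof -
    have ab: "U a \<subseteq> {..<k}" "shift x (U a) = a" "U b \<subseteq> {..<k}" "shift x (U b) = b"
      using U that by metis+
    have sh: "shift a (U b - U a) = b"
      using shift_diff[OF that(3) ab(3), of x] ab by metis
    have an: "a < n" using ab(2) shift_less by metis
    have "sum l (U b) = sum l (U a) + sum l (U b - U a)"
      using sum.subset_diff[OF that(3), of l] finite_subset[OF ab(3)] by simp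
    then have "(x + sum l (U b)) div n = (x + sum l (U a)) div n + (a + sum l (U b - U a)) div n"
      using div_add_mod[of "x + sum l (U a)" "sum l (U b - U a)" n] ab(2)
      by (simp add: shift_def add.assoc)
    moreover have "winding (edge_chain a b)
        = (\<lambda>i. if i < k then of_bool (i \<in> U b - U a) - int ((a + sum l (U b - U a)) div n) else 0)"
      using winding_shift[of a "U b - U a"] an ab(3) sh by (metis Diff_subset subset_trans)
    ultimately show ?thesis using that(3) by (auto simp: F_def fun_eq_iff)
  qed
  have "winding (edge_chain a b) = F b - F a" if ab: "a \<in> t" "b \<in> t" for a b
  proof (cases "U a \<subseteq> U b")
    case False
    then have "winding (edge_chain b a) = F a - F b" using up U(2) ab by blast
    then have "- winding (edge_chain b a) = F b - F a" by simp
    then show ?thesis by (metis edge_chain_swap winding_uminus)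
  qed (use up ab in blast)
  then show thesis by (rule that)
qed

text \<open>A linear map that kills every triangle boundary kills \<open>B\<close>. The values are
  functions so that the rule serves both for \<open>winding\<close> and for the boundary
  operator.\<close>

lemma boundary_induct [consumes 1, case_names triangle]:
  assumes "c \<in> B"
    and "\<And>a b d. {a, b, d} \<in> Q 2 \<Longrightarrow> a < b \<Longrightarrow> b < d \<Longrightarrow>
      f (edge_chain a b + edge_chain b d + edge_chain d a) = (\<lambda>_. 0 :: int)"
    and sum: "\<And>g :: nat set \<Rightarrow> nat set \<Rightarrow> int. f (\<Sum>t\<in>Q 2. g t) = (\<Sum>t\<in>Q 2. f (g t))"
    and smult: "\<And>z c. f (\<lambda>s. z * c s) = (\<lambda>x. z * f c x)"
  shows "f c = (\<lambda>_. 0)"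
proof -
  obtain c' where c: "c = bd n k l 1 c'" using assms(1) unfolding boundaries1_def by blast
  have "c = (\<Sum>t\<in>Q 2. (\<lambda>s. c' t * (\<lambda>s. if s \<in> Q 1 then incid t s else 0) s))"
    unfolding c bd_eq by (simp only: numeral_2_eq_2 One_nat_def)
  then have "f c = (\<Sum>t\<in>Q 2. (\<lambda>x. c' t * f (\<lambda>s. if s \<in> Q 1 then incid t s else 0) x))"
    using sum smult by simp
  also have "\<dots> = (\<Sum>t\<in>Q 2. (\<lambda>x. 0))"
  proof (rule sum.cong[OF refl])
    fix t assume "t \<in> Q 2"
    then obtain a b d where t: "a < b" "b < d" "t = {a, b, d}" using Q2E by metis
    have q: "{a, b, d} \<in> Q 2" using \<open>t \<in> Q 2\<close> t(3) by simp
    have "f (\<lambda>s. if s \<in> Q 1 then incid t s else 0) = (\<lambda>_. 0)"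
      unfolding t(3) incid_triangle[OF q t(1,2)] by (rule assms(2)[OF q t(1,2)])
    then show "(\<lambda>x. c' t * f (\<lambda>s. if s \<in> Q 1 then incid t s else 0) x) = (\<lambda>x. 0)" by simp
  qed
  also have "\<dots> = (\<lambda>_. 0)" by (rule ext) (simp only: sum_fun_apply sum.neutral_const)
  finally show ?thesis .
qed

lemma winding_boundary: "c \<in> B \<Longrightarrow> winding c = (\<lambda>_. 0)"
proof (rule boundary_induct[where f = winding])
  fix a b d assume "{a, b, d} \<in> Q 2"
  then have "{a, b, d} \<in> tonn_simplices n k l" by (simp add: tonn_qsimp_def)
  then obtain F where F: "\<And>u v. u \<in> {a, b, d} \<Longrightarrow> v \<in> {a, b, d} \<Longrightarrow> winding (edge_chain u v) = F v - F u"
    using winding_simplex by blast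
  have "winding (edge_chain a b) = F b - F a" "winding (edge_chain b d) = F d - F b"
      "winding (edge_chain d a) = F a - F d"
    using F by blast+
  then show "winding (edge_chain a b + edge_chain b d + edge_chain d a) = (\<lambda>_. 0)"
    by (simp add: winding_add fun_eq_iff)
qed (simp_all only: winding_sum winding_smult)

text \<open>The edge values add up: indicators give multiplicities, and the carries give the number
  of passages through 0.\<close>

lemma winding_path:
  assumes "y < n" "set ts \<subseteq> {..<k}"
  shows "winding (P y ts)
    = (\<lambda>i. if i < k then int (count (mset ts) i) - int ((y + sum_list (map l ts)) div n) else 0)"
  using assms
proof (induction ts arbitrary: y)
  case Nil
  then show ?case by (simp only: path_Nil winding_zero) (simp add: fun_eq_iff)
next
  case (Cons t ts)
  have "(y + sum_list (map l (t # ts))) div n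
      = (y + sum l {t}) div n + (shift y {t} + sum_list (map l ts)) div n"
    using div_add_mod[of "y + l t" "sum_list (map l ts)" n] by (simp add: shift_def add.assoc)
  moreover have "winding (P y (t # ts)) = winding (edge_chain y (shift y {t})) + winding (P (shift y {t}) ts)"
    using Cons.prems by (simp only: path_Cons winding_add)
  moreover have "winding (P (shift y {t}) ts) = (\<lambda>i. if i < k then int (count (mset ts) i)
      - int ((shift y {t} + sum_list (map l ts)) div n) else 0)"
    using Cons by simp
  moreover have "winding (edge_chain y (shift y {t}))
      = (\<lambda>i. if i < k then of_bool (i \<in> {t}) - int ((y + sum l {t}) div n) else 0)"
    using Cons.prems by (intro winding_shift) auto
  ultimately show ?case by (auto simp: fun_eq_iff)
qed

section \<open>Boundaries of edges and paths, and the windings of cycles\<close>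

lemma bd_edge:
  assumes "{a, b} \<in> Q 1"
  shows "bd n k l 0 (edge_chain a b) = (\<lambda>s. of_bool (s = {b}) - of_bool (s = {a}))"
proof -
  have sorted: "bd n k l 0 (edge_chain a b) = (\<lambda>s. of_bool (s = {b}) - of_bool (s = {a}))"
    if e: "{a, b} \<in> Q 1" "a < b" for a b
  proof
    fix s
    have "a < n" "b < n" using e simplex_less by (auto simp: tonn_qsimp_def)
    then have in0: "{a} \<in> Q 0" "{b} \<in> Q 0" by (auto simp: Q0_iff)
    show "bd n k l 0 (edge_chain a b) s = of_bool (s = {b}) - of_bool (s = {a})"
    proof (cases "s \<in> Q 0")
      case True
      then obtain v where s: "s = {v}" using Q0_iff by blast
      have "bd n k l 0 (edge_chain a b) s = incid {a, b} {v}"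
        using True sum_edge_chain[OF e, of "\<lambda>e. incid e s"] by (simp add: bd_def s)
      then show ?thesis using incid_pair[OF e(2)] e(2) by (simp add: s)
    next
      case False
      then have "s \<noteq> {a}" "s \<noteq> {b}" using in0 by auto
      then show ?thesis using False by (simp add: bd_def)
    qed
  qed
  have "a \<noteq> b" using assms by (auto simp: tonn_qsimp_def)
  then consider "a < b" | "b < a" by linarith
  then show ?thesis
  proof cases
    case 2
    have "edge_chain a b = (\<lambda>s. - 1 * edge_chain b a s)"
      using edge_chain_swap[of a b] by (simp add: fun_eq_iff)
    then have "bd n k l 0 (edge_chain a b) = (\<lambda>s. - 1 * bd n k l 0 (edge_chain b a) s)"
      by (metis bd_smult)
    then show ?thesis using sorted[of b a] assms 2 by (simp add: insert_commute)
  qed (use sorted assms in blast)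
qed

lemma edge_in_carrier: "{a, b} \<in> Q 1 \<Longrightarrow> edge_chain a b \<in> carrier (chain_group n k l 1)"
  by (auto simp: carrier_chain_group edge_chain_def)

lemma step_in_Q1: "y < n \<Longrightarrow> t < k \<Longrightarrow> {y, shift y {t}} \<in> Q 1"
proof (rule Q1_shiftI)
  assume t: "t < k"
  \<comment> \<open>With at least two types, a single step never closes up.\<close>
  have "{..<k} \<noteq> {t}"
  proof
    assume "{..<k} = {t}"
    then have "card {..<k} = card {t}" by simp
    then show False using k2 by simp
  qed
  then show "{t} \<subset> {..<k}" using t by auto
qed auto

lemma path_carrier:
  assumes "y < n" "set ts \<subseteq> {..<k}"
  shows "P y ts \<in> carrier (chain_group n k l 1)"
  using assms
proof (induction ts arbitrary: y)
  case (Cons t ts)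
  have "edge_chain y (shift y {t}) \<in> carrier (chain_group n k l 1)"
    using Cons.prems by (intro edge_in_carrier step_in_Q1) auto
  moreover have "P (shift y {t}) ts \<in> carrier (chain_group n k l 1)" using Cons by simp
  ultimately show ?case using Cons.prems by (simp add: path_Cons carrier_chain_group)
qed (simp add: carrier_chain_group)

lemma bd_path:
  assumes "y < n" "set ts \<subseteq> {..<k}"
  shows "bd n k l 0 (P y ts) = (\<lambda>s. of_bool (s = {end_vertex y ts}) - of_bool (s = {y}))"
  using assms
proof (induction ts arbitrary: y)
  case Nil
  then show ?case by (simp only: path_Nil bd_zero) (simp add: fun_eq_iff)
next
  case (Cons t ts)
  have "bd n k l 0 (P y (t # ts)) = bd n k l 0 (edge_chain y (shift y {t})) + bd n k l 0 (P (shift y {t}) ts)"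
    using Cons.prems by (simp only: path_Cons bd_add)
  moreover have "bd n k l 0 (edge_chain y (shift y {t})) = (\<lambda>s. of_bool (s = {shift y {t}}) - of_bool (s = {y}))"
    using Cons.prems by (intro bd_edge step_in_Q1) auto
  moreover have "bd n k l 0 (P (shift y {t}) ts)
      = (\<lambda>s. of_bool (s = {end_vertex y (t # ts)}) - of_bool (s = {shift y {t}}))"
    using Cons by (simp add: end_vertex_Cons)
  ultimately show ?case by (simp add: fun_eq_iff)
qed

lemma closed_path_cycle:
  assumes "y < n" "set ts \<subseteq> {..<k}" "end_vertex y ts = y"
  shows "P y ts \<in> cycles1 n k l"
  using path_carrier[OF assms(1,2)] bd_path[OF assms(1,2)] assms(3)
  by (simp add: cycles1_def)

lemma boundary_cycle: "c \<in> B \<Longrightarrow> c \<in> cycles1 n k l"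
proof -
  assume c: "c \<in> B"
  have "bd n k l 0 c = (\<lambda>_. 0)"
    using c
  proof (rule boundary_induct[where f = "bd n k l 0"])
    fix a b d assume t: "{a, b, d} \<in> Q 2" "a < b" "b < d"
    have "{a, b} \<in> Q 1" "{b, d} \<in> Q 1" "{d, a} \<in> Q 1"
      using Q_triangle_faces[OF t(1)] t by (auto simp: insert_commute)
    then show "bd n k l 0 (edge_chain a b + edge_chain b d + edge_chain d a) = (\<lambda>_. 0)"
      by (simp add: bd_add bd_edge fun_eq_iff)
  qed (simp_all only: bd_sum bd_smult)
  moreover have "c \<in> carrier (chain_group n k l 1)"
    using c by (auto simp: boundaries1_def carrier_chain_group bd_def)
  ultimately show ?thesis by (simp add: cycles1_def)
qed

text \<open>Pairing a chain with the coboundary of \<open>f\<close> equals pairing its boundary with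
  \<open>f\<close>. It is applied to the vertex label and, later, to coefficients of chosen
  paths.\<close>

lemma sum_by_parts:
  "(\<Sum>e\<in>Q 1. c e * (f (Max e) - f (Min e))) = (\<Sum>v<n. bd n k l 0 c {v} * f v)" for f :: "nat \<Rightarrow> int"
proof -
  have edge: "(\<Sum>v<n. incid e {v} * f v) = f (Max e) - f (Min e)" if "e \<in> Q 1" for e
  proof -
    obtain a b where e: "a < b" "b < n" "e = {a, b}" using Q1E \<open>e \<in> Q 1\<close> by metis
    have "(\<Sum>v<n. incid e {v} * f v) = (\<Sum>v\<in>{a, b}. incid e {v} * f v)"
      by (rule sum.mono_neutral_right) (use e in \<open>auto simp: incid_pair\<close>)
    also have "\<dots> = f b - f a" using e by (simp add: incid_pair)
    finally show ?thesis using e by (simp add: max_def min_def)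
  qed
  have "(\<Sum>v<n. bd n k l 0 c {v} * f v) = (\<Sum>v<n. \<Sum>e\<in>Q 1. c e * (incid e {v} * f v))"
    by (rule sum.cong) (auto simp: bd_def Q0_iff sum_distrib_right mult.assoc)
  also have "\<dots> = (\<Sum>e\<in>Q 1. c e * (\<Sum>v<n. incid e {v} * f v))"
    by (subst sum.swap) (simp add: sum_distrib_left)
  also have "\<dots> = (\<Sum>e\<in>Q 1. c e * (f (Max e) - f (Min e)))"
    by (rule sum.cong) (auto simp: edge)
  finally show ?thesis by simp
qed

lemma winding_cycle:
  assumes "c \<in> cycles1 n k l"
  shows "winding c \<in> carrier (lattice_HL k l)"
proof -
  have edge: "type_set (Max e - Min e) \<subseteq> {..<k} \<and> int (sum l (type_set (Max e - Min e))) = int (Max e) - int (Min e)"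
    if "e \<in> Q 1" for e
  proof -
    obtain a b where e: "a < b" "b < n" "e = {a, b}" using Q1E \<open>e \<in> Q 1\<close> by metis
    then obtain I where I: "I \<subseteq> {..<k}" "b = a + sum l I" using Q1_shift \<open>e \<in> Q 1\<close> by metis
    have "Max e = b" "Min e = a" using e by auto
    then show ?thesis using I type_set_sum[OF I(1)] by simp
  qed
  have "(\<Sum>i<k. winding c i * int (l i))
      = (\<Sum>i<k. \<Sum>e\<in>Q 1. c e * (of_bool (i \<in> type_set (Max e - Min e)) * int (l i)))"
    by (simp add: winding_def sum_distrib_right mult.assoc)
  also have "\<dots> = (\<Sum>e\<in>Q 1. c e * (\<Sum>i<k. of_bool (i \<in> type_set (Max e - Min e)) * int (l i)))"
    by (subst sum.swap) (simp only: sum_distrib_left)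
  \<comment> \<open>The lengths of the types of an edge add up to its label difference, so the
    pairing with \<open>l\<close> is the coboundary of the label and vanishes on cycles.\<close>
  also have "\<dots> = (\<Sum>e\<in>Q 1. c e * (int (Max e) - int (Min e)))"
  proof (rule sum.cong[OF refl])
    fix e assume "e \<in> Q 1"
    let ?I = "type_set (Max e - Min e)"
    have "(\<Sum>i<k. of_bool (i \<in> ?I) * int (l i)) = (\<Sum>i\<in>?I. int (l i))"
      using edge[OF \<open>e \<in> Q 1\<close>] by (intro sum.mono_neutral_cong_right) auto
    then show "c e * (\<Sum>i<k. of_bool (i \<in> ?I) * int (l i)) = c e * (int (Max e) - int (Min e))"
      using edge[OF \<open>e \<in> Q 1\<close>] by simp
  qed
  also have "\<dots> = 0"
    using assms unfolding sum_by_parts by (simp add: cycles1_def)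
  finally have "(\<Sum>i<k. winding c i * int (l i)) = 0" .
  moreover have "winding c i = 0" if "k \<le> i" for i
  proof -
    have "i \<notin> type_set (Max e - Min e)" if "e \<in> Q 1" for e
      using edge[OF that] \<open>k \<le> i\<close> by auto
    then show ?thesis by (simp add: winding_def)
  qed
  ultimately show ?thesis by (simp add: lattice_HL_def)
qed

section \<open>Cycles as closed paths\<close>

lemma reach:
  assumes "y < n" "v < n"
  obtains ts where "set ts \<subseteq> {..<k}" "end_vertex y ts = v"
proof -
  obtain x where x: "(\<Sum>i<k. x i * int (l i)) = 1"
    using Gcd_bezout[where m = k and l = l] reduced by (auto simp: reduced_def)
  define d where "d = int v - int y"
  \<comment> \<open>Bezout coefficients scaled by the required displacement \<open>d\<close> may be
    negative; reducing them modulo \<open>n\<close> yields multiplicities without changing the end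
    vertex.\<close>
  obtain ts where ts: "set ts \<subseteq> {..<k}" "\<And>i. i < k \<Longrightarrow> count (mset ts) i = nat (d * x i mod int n)"
    using list_of_counts[where p = "\<lambda>i. nat (d * x i mod int n)" and k = k] by blast
  have "int (sum_list (map l ts)) mod int n = (\<Sum>i<k. (d * x i mod int n) * int (l i)) mod int n"
    using ts n_pos by (simp add: sum_list_count_mset)
  also have "\<dots> = (\<Sum>i<k. ((d * x i mod int n) * int (l i)) mod int n) mod int n"
    by (simp only: mod_sum_eq)
  also have "\<dots> = (\<Sum>i<k. (d * x i * int (l i)) mod int n) mod int n"
    by (simp only: mod_mult_left_eq)
  also have "\<dots> = (d * (\<Sum>i<k. x i * int (l i))) mod int n"
    by (simp only: mod_sum_eq sum_distrib_left mult.assoc)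
  also have "\<dots> = d mod int n" by (simp add: x)
  finally have "(int y + int (sum_list (map l ts))) mod int n = (int y + d) mod int n"
    by (metis mod_add_right_eq)
  then have "int (end_vertex y ts) = int v"
    using assms(2) by (simp add: end_vertex_def d_def zmod_int)
  with ts show thesis by (intro that[of ts]) auto
qed

text \<open>The chains represented by one closed path at 0. They are shown to be closed under
  integer linear combinations and then to include all cycles.\<close>

definition loop :: "(nat set \<Rightarrow> int) \<Rightarrow> bool" where
  "loop c \<longleftrightarrow> (\<exists>ts. set ts \<subseteq> {..<k} \<and> end_vertex 0 ts = 0 \<and> c \<approx>\<^sub>h P 0 ts)"

lemma loop_zero: "loop 0"
  unfolding loop_def using n_pos by (intro exI[of _ "[]"]) simp

lemma loop_cong: "c \<approx>\<^sub>h d \<Longrightarrow> loop d \<Longrightarrow> loop c"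
  unfolding loop_def using homologous_trans by blast

lemma loop_add:
  assumes "loop c" "loop d"
  shows "loop (c + d)"
proof -
  obtain ts us where ts: "set ts \<subseteq> {..<k}" "end_vertex 0 ts = 0" "c \<approx>\<^sub>h P 0 ts"
    and us: "set us \<subseteq> {..<k}" "end_vertex 0 us = 0" "d \<approx>\<^sub>h P 0 us"
    using assms unfolding loop_def by blast
  have "P 0 (ts @ us) = P 0 ts + P 0 us"
    using path_append[OF n_pos, of ts us] ts by (simp only:)
  then have "c + d \<approx>\<^sub>h P 0 (ts @ us)" using homologous_add ts us by metis
  moreover have "end_vertex 0 (ts @ us) = 0" using ts us by (simp add: end_vertex_append)
  moreover have "set (ts @ us) \<subseteq> {..<k}" using ts us by simp
  ultimately show ?thesis unfolding loop_def by blast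
qed

text \<open>The inverse of a closed path is obtained by completing it to a path that makes
  the same number of steps of every type.\<close>

lemma loop_uminus:
  assumes "loop c"
  shows "loop (- c)"
proof -
  obtain ts where ts: "set ts \<subseteq> {..<k}" "end_vertex 0 ts = 0" "c \<approx>\<^sub>h P 0 ts"
    using assms unfolding loop_def by blast
  \<comment> \<open>The length bounds every multiplicity, so the subtractions below do not
    truncate.\<close>
  define m where "m = length ts"
  obtain us where us: "set us \<subseteq> {..<k}" "\<And>i. i < k \<Longrightarrow> count (mset us) i = m - count (mset ts) i"
    using list_of_counts[where p = "\<lambda>i. m - count (mset ts) i" and k = k] by blast
  have bal: "count (mset (ts @ us)) i = m" if "i < k" for i
    using us(2)[OF that] count_le_length[of ts i] by (simp add: m_def count_mset)
  have sub: "set (ts @ us) \<subseteq> {..<k}" using ts us by simp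
  have "sum_list (map l (ts @ us)) = (\<Sum>i<k. m * l i)"
    unfolding sum_list_count_mset[OF sub] by (rule sum.cong) (use bal in simp_all)
  also have "\<dots> = m * n" by (simp only: n_eq sum_distrib_left)
  finally have "end_vertex 0 (ts @ us) = 0" by (simp only: end_vertex_def) simp
  then have e: "end_vertex 0 us = 0" using ts by (simp add: end_vertex_append)
  have "P 0 (ts @ us) = P 0 ts + P 0 us"
    using path_append[OF n_pos, of ts us] ts by (simp only:)
  then have "P 0 ts + P 0 us \<approx>\<^sub>h 0" using path_balanced[OF n_pos sub bal] by metis
  from homologous_diff[OF this ts(3)[THEN homologous_sym]]
  have "P 0 us \<approx>\<^sub>h - c" by (simp add: homologous_def)
  then show ?thesis unfolding loop_def using us(1) e homologous_sym by blast
qed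

lemma loop_smult: "loop c \<Longrightarrow> loop (\<lambda>s. z * c s)"
proof -
  assume c: "loop c"
  have nat: "loop (\<lambda>s. int m * c s)" for m
  proof (induction m)
    case 0
    have "(\<lambda>s. int 0 * c s) = 0" by (simp add: fun_eq_iff)
    then show ?case using loop_zero by metis
  next
    case (Suc m)
    have "(\<lambda>s. int (Suc m) * c s) = c + (\<lambda>s. int m * c s)"
      by (simp add: fun_eq_iff distrib_right)
    then show ?case using loop_add[OF c Suc] by metis
  qed
  have "(\<lambda>s. z * c s) = (if z \<ge> 0 then (\<lambda>s. int (nat z) * c s) else - (\<lambda>s. int (nat (- z)) * c s))"
    by (simp add: fun_eq_iff)
  then show ?thesis using nat loop_uminus by metis
qed

lemma loop_sum: "(\<And>x. x \<in> A \<Longrightarrow> loop (f x)) \<Longrightarrow> loop (\<Sum>x\<in>A. f x)"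
proof (induction A rule: infinite_finite_induct)
  case (insert x F)
  then show ?case unfolding sum.insert[OF insert.hyps] by (intro loop_add) simp_all
qed (simp_all only: sum.infinite sum.empty loop_zero not_False_eq_True)

text \<open>The same return path \<open>vs\<close> closes both paths, and its contributions cancel
  in the difference.\<close>

lemma loop_paths_diff:
  assumes "set ts \<subseteq> {..<k}" "set us \<subseteq> {..<k}" "end_vertex 0 ts = end_vertex 0 us"
  shows "loop (P 0 ts - P 0 us)"
proof -
  obtain vs where vs: "set vs \<subseteq> {..<k}" "end_vertex (end_vertex 0 ts) vs = 0"
    using reach[OF end_vertex_less n_pos] by metis
  have closed: "loop (P 0 (ws @ vs))" if "set ws \<subseteq> {..<k}" "end_vertex 0 ws = end_vertex 0 ts" for ws
    unfolding loop_def using that vs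
    by (intro exI[of _ "ws @ vs"]) (simp only: end_vertex_append set_append Un_subset_iff homologous_refl simp_thms)
  have "P 0 ts - P 0 us = P 0 (ts @ vs) + - P 0 (us @ vs)"
    using path_append[OF n_pos, of ts vs] path_append[OF n_pos, of us vs] assms(3)
    by (simp add: algebra_simps)
  then show ?thesis using loop_add[OF closed loop_uminus[OF closed]] assms by metis
qed

lemma cycle_loop:
  assumes c: "c \<in> cycles1 n k l"
  shows "loop c"
proof -
  have "\<exists>ts. set ts \<subseteq> {..<k} \<and> end_vertex 0 ts = v" if "v < n" for v
    using reach[OF n_pos that] by metis
  then obtain \<tau> where \<tau>: "\<And>v. v < n \<Longrightarrow> set (\<tau> v) \<subseteq> {..<k} \<and> end_vertex 0 (\<tau> v) = v"
    by metis
  \<comment> \<open>Each edge is completed to a closed chain by the chosen paths from 0 to its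
    endpoints.\<close>
  define E where "E e = edge_chain (Min e) (Max e) + P 0 (\<tau> (Min e)) - P 0 (\<tau> (Max e))" for e
  have loop_E: "loop (E e)" if "e \<in> Q 1" for e
  proof -
    obtain a b where e: "a < b" "b < n" "e = {a, b}" using Q1E \<open>e \<in> Q 1\<close> by metis
    then have ab: "Min e = a" "Max e = b" by auto
    obtain I where I: "I \<subseteq> {..<k}" "b = shift a I" using Q1_shift \<open>e \<in> Q 1\<close> e by metis
    have fin: "finite I" using I(1) finite_subset by blast
    \<comment> \<open>An edge may combine several types; it is replaced by single steps in order to
      be part of a path.\<close>
    define ss where "ss = sorted_list_of_set I"
    have ss: "distinct ss" "set ss = I" using fin by (auto simp: ss_def)
    have ea: "end_vertex 0 (\<tau> a) = a" "set (\<tau> a) \<subseteq> {..<k}" "end_vertex 0 (\<tau> b) = b" "set (\<tau> b) \<subseteq> {..<k}"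
      using \<tau>[of a] \<tau>[of b] e by auto
    have p: "P 0 (\<tau> a @ ss) = P 0 (\<tau> a) + P a ss"
      using path_append[OF n_pos, of "\<tau> a" ss] ea by (simp only:)
    have "P a ss \<approx>\<^sub>h edge_chain a b"
      using path_distinct[of a ss] e ss I by simp
    then have "edge_chain a b + (P 0 (\<tau> a) - P 0 (\<tau> b)) \<approx>\<^sub>h P a ss + (P 0 (\<tau> a) - P 0 (\<tau> b))"
      using homologous_add homologous_sym homologous_refl by metis
    moreover have "P a ss + (P 0 (\<tau> a) - P 0 (\<tau> b)) = P 0 (\<tau> a @ ss) - P 0 (\<tau> b)"
      unfolding p by (simp add: algebra_simps)
    moreover have "E e = edge_chain a b + (P 0 (\<tau> a) - P 0 (\<tau> b))"
      unfolding E_def ab by (simp add: algebra_simps)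
    moreover have "loop (P 0 (\<tau> a @ ss) - P 0 (\<tau> b))"
    proof (rule loop_paths_diff)
      show "end_vertex 0 (\<tau> a @ ss) = end_vertex 0 (\<tau> b)"
        unfolding end_vertex_append ea end_vertex_distinct[OF ss(1)] ss(2) I(2)[symmetric] ..
    qed (use ea ss I in auto)
    ultimately show ?thesis using loop_cong by metis
  qed
  have "c = (\<Sum>e\<in>Q 1. (\<lambda>s. c e * E e s))"
  proof
    fix s
    \<comment> \<open>Summation by parts, for each 1-simplex \<open>s\<close> separately, shows that
      the added paths cancel because \<open>c\<close> has zero boundary.\<close>
    let ?f = "\<lambda>v. P 0 (\<tau> v) s"
    have "(\<Sum>e\<in>Q 1. c e * (?f (Max e) - ?f (Min e))) = 0"
      using c sum_by_parts[where f = ?f and c = c] by (simp add: cycles1_def)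
    moreover have "(\<Sum>e\<in>Q 1. c e * edge_chain (Min e) (Max e) s) = c s"
    proof -
      have "c e * edge_chain (Min e) (Max e) s = (if e = s then c e else 0)" if "e \<in> Q 1" for e
      proof -
        obtain a b where e: "a < b" "b < n" "e = {a, b}" using Q1E \<open>e \<in> Q 1\<close> by metis
        then have ab: "Min e = a" "Max e = b" by auto
        show ?thesis unfolding ab using e by (auto simp: edge_chain_def)
      qed
      then have "(\<Sum>e\<in>Q 1. c e * edge_chain (Min e) (Max e) s) = (\<Sum>e\<in>Q 1. if e = s then c e else 0)"
        by (rule sum.cong[OF refl])
      also have "\<dots> = (if s \<in> Q 1 then c s else 0)" by (rule sum.delta[OF finite_Q])
      also have "\<dots> = c s" using c by (auto simp: cycles1_def carrier_chain_group)
      finally show ?thesis .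
    qed
    moreover have "(\<Sum>e\<in>Q 1. (\<lambda>s. c e * E e s)) s
      = (\<Sum>e\<in>Q 1. c e * edge_chain (Min e) (Max e) s) - (\<Sum>e\<in>Q 1. c e * (?f (Max e) - ?f (Min e)))"
      unfolding sum_fun_apply sum_subtractf[symmetric] E_def
      by (rule sum.cong) (simp_all add: algebra_simps)
    ultimately show "c s = (\<Sum>e\<in>Q 1. (\<lambda>s. c e * E e s)) s" by simp
  qed
  then show ?thesis using loop_sum[of "Q 1" "\<lambda>e s. c e * E e s"] loop_smult loop_E by metis
qed

section \<open>Kernel and image of the winding on cycles\<close>

lemma winding_zero_boundary:
  assumes "c \<in> cycles1 n k l" "winding c = (\<lambda>_. 0)"
  shows "c \<in> B"
proof -
  obtain ts where ts: "set ts \<subseteq> {..<k}" "c \<approx>\<^sub>h P 0 ts"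
    using cycle_loop[OF assms(1)] unfolding loop_def by blast
  have "winding c = winding (P 0 ts) + winding (c - P 0 ts)"
    by (simp flip: winding_add)
  also have "winding (c - P 0 ts) = (\<lambda>_. 0)"
    using ts(2) winding_boundary by (simp only: homologous_def)
  finally have zero: "winding (P 0 ts) = (\<lambda>_. 0)" using assms(2) by (simp add: fun_eq_iff)
  \<comment> \<open>Zero winding says that each type occurs as often as the path passes 0, a number
    independent of \<open>i\<close>; so the path is balanced.\<close>
  have "count (mset ts) i = (0 + sum_list (map l ts)) div n" if "i < k" for i
  proof -
    have "int (count (mset ts) i) - int ((0 + sum_list (map l ts)) div n) = 0"
      using fun_cong[OF zero, of i] that unfolding winding_path[OF n_pos ts(1)] by (simp only: if_True)
    then show ?thesis by (metis eq_iff_diff_eq_0 of_nat_eq_iff)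
  qed
  then have "P 0 ts \<approx>\<^sub>h 0" by (rule path_balanced[OF n_pos ts(1)])
  then have "c \<approx>\<^sub>h 0" using ts(2) homologous_trans by blast
  then show ?thesis by (simp only: homologous_def diff_0_right)
qed

lemma winding_closed_path:
  assumes "y < n" "set ts \<subseteq> {..<k}" "(\<Sum>i<k. count (mset ts) i * l i) = p * n"
  shows "P y ts \<in> cycles1 n k l"
    and "winding (P y ts) = (\<lambda>i. if i < k then int (count (mset ts) i) - int p else 0)"
proof -
  have s: "sum_list (map l ts) = p * n" using sum_list_count_mset[OF assms(2)] assms(3) by simp
  then have "end_vertex y ts = y" using assms(1) by (simp add: end_vertex_def)
  then show "P y ts \<in> cycles1 n k l" by (rule closed_path_cycle[OF assms(1,2)])
  have q: "(y + sum_list (map l ts)) div n = p" using assms(1) s by simp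
  show "winding (P y ts) = (\<lambda>i. if i < k then int (count (mset ts) i) - int p else 0)"
    unfolding winding_path[OF assms(1,2)] q by (rule refl)
qed

lemma winding_surj:
  assumes x: "x \<in> carrier (lattice_HL k l)"
  obtains c where "c \<in> cycles1 n k l" "winding c = x"
proof -
  \<comment> \<open>A constant large enough to make all \<open>x i + p\<close> nonnegative. As
    \<open>x\<close> is a relation, steps with these multiplicities have total length
    \<open>p * n\<close>, so the winding subtracts \<open>p\<close> again.\<close>
  define p where "p = nat (\<Sum>i<k. \<bar>x i\<bar>)"
  have nonneg: "0 \<le> x i + int p" if "i < k" for i
  proof -
    have "\<bar>x i\<bar> \<le> (\<Sum>i<k. \<bar>x i\<bar>)"
      by (rule member_le_sum) (use that in auto)
    then show ?thesis by (simp add: p_def)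
  qed
  obtain ts where ts: "set ts \<subseteq> {..<k}" "\<And>i. i < k \<Longrightarrow> count (mset ts) i = nat (x i + int p)"
    using list_of_counts[where p = "\<lambda>i. nat (x i + int p)" and k = k] by blast
  have "int (\<Sum>i<k. count (mset ts) i * l i) = (\<Sum>i<k. x i * int (l i) + int p * int (l i))"
    unfolding of_nat_sum by (rule sum.cong) (use ts nonneg in \<open>auto simp: algebra_simps\<close>)
  also have "\<dots> = int p * int n"
    using x unfolding n_eq by (simp add: sum.distrib lattice_HL_def sum_distrib_left)
  finally have "(\<Sum>i<k. count (mset ts) i * l i) = p * n" by (metis of_nat_eq_iff of_nat_mult)
  note closed = winding_closed_path[OF n_pos ts(1) this]
  have "winding (P 0 ts) = x"
    unfolding closed(2) using x ts(2) nonneg by (auto simp: fun_eq_iff lattice_HL_def)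
  with closed(1) show thesis by (rule that)
qed

section \<open>The isomorphism induced on homology\<close>

abbreviation Z where "Z \<equiv> (chain_group n k l 1)\<lparr>carrier := cycles1 n k l\<rparr>"

lemma mult_Z: "c \<otimes>\<^bsub>Z\<^esub> d = c + d" and one_Z: "\<one>\<^bsub>Z\<^esub> = 0" and carrier_Z: "carrier Z = cycles1 n k l"
  by (simp_all add: chain_group_def fun_eq_iff)

lemma group_Z: "group Z"
proof (rule groupI)
  have bd: "c \<in> cycles1 n k l \<longleftrightarrow> (\<forall>s. s \<notin> Q 1 \<longrightarrow> c s = 0) \<and> bd n k l 0 c = 0" for c
    by (simp add: cycles1_def carrier_chain_group zero_fun_def)
  show "c \<otimes>\<^bsub>Z\<^esub> d \<in> carrier Z" if "c \<in> carrier Z" "d \<in> carrier Z" for c d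
    using that unfolding mult_Z carrier_Z bd bd_add by simp
  show "\<one>\<^bsub>Z\<^esub> \<in> carrier Z" unfolding one_Z carrier_Z bd bd_zero by simp
  show "\<exists>d\<in>carrier Z. d \<otimes>\<^bsub>Z\<^esub> c = \<one>\<^bsub>Z\<^esub>" if "c \<in> carrier Z" for c
  proof (rule bexI[of _ "0 - c"])
    show "0 - c \<in> carrier Z" using that unfolding carrier_Z bd bd_diff by simp
  qed (simp only: mult_Z one_Z diff_add_cancel)
qed (simp_all only: mult_Z one_Z add.assoc add_0_left)

lemma group_lattice: "group (lattice_HL k l)"
proof (rule groupI)
  fix x assume "x \<in> carrier (lattice_HL k l)"
  then show "\<exists>y\<in>carrier (lattice_HL k l). y \<otimes>\<^bsub>lattice_HL k l\<^esub> x = \<one>\<^bsub>lattice_HL k l\<^esub>"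
    by (intro bexI[of _ "\<lambda>i. - x i"]) (auto simp: lattice_HL_def sum_negf)
qed (auto simp: lattice_HL_def distrib_right sum.distrib add.assoc)

lemma winding_group_hom: "group_hom Z (lattice_HL k l) winding"
proof -
  have "winding \<in> hom Z (lattice_HL k l)"
    unfolding hom_def carrier_Z mult_Z using winding_cycle
    by (auto simp: winding_add lattice_HL_def fun_eq_iff)
  then show ?thesis
    by (intro group_hom.intro group_hom_axioms.intro group_Z group_lattice)
qed

lemma winding_kernel: "kernel Z (lattice_HL k l) winding = B"
  unfolding kernel_def carrier_Z
  using winding_zero_boundary winding_boundary boundary_cycle by (auto simp: lattice_HL_def)

text \<open>First isomorphism theorem; \<open>the_elem\<close> extracts the common value of
  \<open>winding\<close> on a coset.\<close>

lemma winding_iso: "(\<lambda>A. the_elem (winding ` A)) \<in> iso (H1_tonn n k l) (lattice_HL k l)"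
proof -
  have "winding ` carrier Z = carrier (lattice_HL k l)"
    unfolding carrier_Z using winding_cycle winding_surj by blast
  from group_hom.FactGroup_iso_set[OF winding_group_hom this]
  show ?thesis unfolding winding_kernel H1_tonn_def .
qed

lemma winding_coset: "the_elem (winding ` (r_coset Z B c)) = winding c"
proof -
  have w: "winding (b + c) = winding c" if "b \<in> B" for b
    using winding_boundary[OF that] by (simp add: winding_add fun_eq_iff)
  have "r_coset Z B c = (\<lambda>b. b + c) ` B"
    unfolding r_coset_def mult_Z by blast
  then have "winding ` (r_coset Z B c) = (\<lambda>b. winding c) ` B"
    using w by (simp add: image_image)
  also have "\<dots> = {winding c}" using boundaries1_zero by blast
  finally show ?thesis by (simp only: the_elem_eq)
qed

end

section \<open>The lattice of integer relations\<close>

text \<open>The least positive element divides every other one, since a nonzero remainder would be a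
  smaller positive element.\<close>

lemma int_subgroup_generator:
  fixes S :: "int set"
  assumes "0 \<in> S" and diff: "\<And>x y. x \<in> S \<Longrightarrow> y \<in> S \<Longrightarrow> x - y \<in> S" and "z \<in> S" "z > 0"
  obtains d where "d > 0" "d \<in> S" "\<And>x. x \<in> S \<Longrightarrow> d dvd x"
proof -
  define d where "d = int (LEAST m::nat. m > 0 \<and> int m \<in> S)"
  have ex: "\<exists>m::nat. m > 0 \<and> int m \<in> S"
    using assms(3,4) by (intro exI[of _ "nat z"]) auto
  have d: "d > 0" "d \<in> S"
    using LeastI_ex[OF ex] by (auto simp: d_def)
  have minus: "- x \<in> S" if "x \<in> S" for x using diff[OF assms(1) that] by simp
  have add: "x + y \<in> S" if "x \<in> S" "y \<in> S" for x y using diff[OF that(1) minus[OF that(2)]] by simp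
  have mult_nat: "int m * d \<in> S" for m
    by (induction m) (auto simp: assms(1) algebra_simps intro: add d)
  have mult: "q * d \<in> S" for q
    using mult_nat[of "nat q"] minus[OF mult_nat[of "nat (- q)"]] by (cases "q \<ge> 0") auto
  have "d dvd x" if "x \<in> S" for x
  proof (rule ccontr)
    assume "\<not> d dvd x"
    then have "0 < x mod d" "x mod d < d"
      using d by (auto simp: dvd_eq_mod_eq_0 order.not_eq_order_implies_strict)
    moreover have "x mod d \<in> S"
      using diff[OF that mult[of "x div d"]] by (simp add: minus_div_mult_eq_mod)
    ultimately have "(LEAST m::nat. m > 0 \<and> int m \<in> S) \<le> nat (x mod d)"
      by (intro Least_le) auto
    then show False using \<open>x mod d < d\<close> \<open>0 < x mod d\<close> by (simp add: d_def)
  qed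
  with d that show thesis by blast
qed

text \<open>A plain set, convenient for an induction that varies the number of coordinates.\<close>

definition relations :: "nat \<Rightarrow> (nat \<Rightarrow> nat) \<Rightarrow> (nat \<Rightarrow> int) set" where
  "relations k l = {x. (\<forall>i\<ge>k. x i = 0) \<and> (\<Sum>i<k. x i * int (l i)) = 0}"

lemma carrier_lattice: "carrier (lattice_HL k l) = relations k l"
  by (simp add: lattice_HL_def relations_def)

lemma relations_diff: "x \<in> relations k l \<Longrightarrow> y \<in> relations k l \<Longrightarrow> (\<lambda>i. x i - y i) \<in> relations k l"
  by (simp add: relations_def left_diff_distrib sum_subtractf)

lemma relations_smult: "x \<in> relations k l \<Longrightarrow> (\<lambda>i. c * x i) \<in> relations k l"
  by (simp add: relations_def mult.assoc flip: sum_distrib_left)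

text \<open>Induction on the number of coordinates. The last coordinate maps the relations onto a
  nonzero subgroup of the integers, with the shorter relations as kernel; a preimage of a generator
  extends their basis by one vector.\<close>

lemma relations_basis:
  assumes "\<And>i. i \<le> m \<Longrightarrow> 0 < l i"
  shows "\<exists>b :: nat \<Rightarrow> nat \<Rightarrow> int. bij_betw (\<lambda>c i. \<Sum>j<m. c j * b j i)
           {c. \<forall>j\<ge>m. c j = 0} (relations (Suc m) l)"
  using assms
proof (induction m)
  case 0
  have "{c::nat\<Rightarrow>int. \<forall>j\<ge>0. c j = 0} = {\<lambda>_. 0}" by auto
  moreover have "relations (Suc 0) l = {\<lambda>_. 0}"
  proof -
    have "x = (\<lambda>_. 0)" if "x \<in> relations (Suc 0) l" for x
    proof
      fix i show "x i = 0" using that 0[of 0] by (cases "i = 0") (auto simp: relations_def)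
    qed
    then show ?thesis by (auto simp: relations_def)
  qed
  ultimately show ?case by simp
next
  case (Suc m)
  let ?R = "relations (Suc m) l" and ?R' = "relations (Suc (Suc m)) l"
  obtain b where b: "bij_betw (\<lambda>c i. \<Sum>j<m. c j * b j i) {c. \<forall>j\<ge>m. c j = 0} ?R"
    using Suc by fastforce
  have sub: "?R = {x \<in> ?R'. x (Suc m) = 0}"
    by (auto simp: relations_def) (metis Suc_leI le_neq_implies_less)
  \<comment> \<open>A relation between the first and the last length, showing that some last
    coordinate is positive.\<close>
  define z where "z i = (if i = 0 then - int (l (Suc m)) else if i = Suc m then int (l 0) else 0)" for i
  have "(\<Sum>i<Suc (Suc m). z i * int (l i)) = (\<Sum>i\<in>{0, Suc m}. z i * int (l i))"
    by (rule sum.mono_neutral_right) (auto simp: z_def)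
  then have "z \<in> ?R'" by (auto simp: relations_def z_def)
  obtain d where d: "d > 0" "d \<in> (\<lambda>x. x (Suc m)) ` ?R'"
      "\<And>x. x \<in> (\<lambda>x. x (Suc m)) ` ?R' \<Longrightarrow> d dvd x"
  proof (rule int_subgroup_generator[of "(\<lambda>x. x (Suc m)) ` ?R'" "z (Suc m)"])
    show "0 \<in> (\<lambda>x. x (Suc m)) ` ?R'"
      by (rule image_eqI[of _ _ "\<lambda>_. 0"]) (auto simp: relations_def)
    show "x - y \<in> (\<lambda>x. x (Suc m)) ` ?R'"
      if "x \<in> (\<lambda>x. x (Suc m)) ` ?R'" "y \<in> (\<lambda>x. x (Suc m)) ` ?R'" for x y
      using that relations_diff by fastforce
    show "0 < z (Suc m)" using Suc.prems[of 0] by (simp add: z_def)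
  qed (use \<open>z \<in> ?R'\<close> in auto)
  then obtain u where u: "u \<in> ?R'" "u (Suc m) = d" by auto
  define b' where "b' = b(m := u)"
  \<comment> \<open>Resetting coefficient \<open>m\<close> to 0 makes the first summand a
    combination of the old basis in the form required by the induction hypothesis.\<close>
  have eq: "(\<lambda>i. \<Sum>j<Suc m. c j * b' j i) = (\<lambda>i. (\<Sum>j<m. (c(m := 0)) j * b j i) + c m * u i)" for c
    by (auto simp: b'_def)
  have old: "(\<lambda>i. \<Sum>j<m. c j * b j i) \<in> ?R" if "\<forall>j\<ge>m. c j = 0" for c
    using b that by (auto simp: bij_betw_def)
  have top: "(\<Sum>j<m. (c(m := 0)) j * b j (Suc m)) = 0" if "\<forall>j\<ge>Suc m. c j = 0" for c
  proof -
    have "\<forall>j\<ge>m. (c(m := 0)) j = 0" using that by auto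
    from old[OF this] show ?thesis by (auto simp: sub)
  qed
  let ?F = "\<lambda>c i. (\<Sum>j<m. (c(m := 0)) j * b j i) + c m * u i"
  have "bij_betw (\<lambda>c i. \<Sum>j<Suc m. c j * b' j i) {c. \<forall>j\<ge>Suc m. c j = 0} ?R'"
    unfolding eq bij_betw_def
  proof (intro conjI subset_antisym subsetI)
    show "inj_on ?F {c. \<forall>j\<ge>Suc m. c j = 0}"
    proof (rule inj_onI)
      fix c c' assume c: "c \<in> {c. \<forall>j\<ge>Suc m. c j = 0}" "c' \<in> {c. \<forall>j\<ge>Suc m. c j = 0}"
        and e: "(\<lambda>i. (\<Sum>j<m. (c(m := 0)) j * b j i) + c m * u i)
              = (\<lambda>i. (\<Sum>j<m. (c'(m := 0)) j * b j i) + c' m * u i)"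
      have m: "c m = c' m"
        using fun_cong[OF e, of "Suc m"] top[of c] top[of c'] c u d by simp
      then have "(\<lambda>i. (\<Sum>j<m. (c(m := 0)) j * b j i)) = (\<lambda>i. (\<Sum>j<m. (c'(m := 0)) j * b j i))"
        using e by (auto simp: fun_eq_iff)
      then have "c(m := 0) = c'(m := 0)"
        by (rule inj_onD[OF bij_betw_imp_inj_on[OF b]])
          (use c in \<open>simp_all add: Suc_le_eq\<close>)
      with m show "c = c'" by (metis fun_upd_triv fun_upd_upd)
    qed
  next
    fix x assume "x \<in> ?F ` {c. \<forall>j\<ge>Suc m. c j = 0}"
    then obtain c where c: "\<forall>j\<ge>Suc m. c j = 0"
      and x: "x = (\<lambda>i. (\<Sum>j<m. (c(m := 0)) j * b j i) + c m * u i)" by blast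
    have "\<forall>j\<ge>m. (c(m := 0)) j = 0" using c by auto
    then have "(\<lambda>i. \<Sum>j<m. (c(m := 0)) j * b j i) \<in> ?R'" using old sub by blast
    from relations_diff[OF this relations_smult[OF u(1), of "- c m"]]
    show "x \<in> ?R'" by (simp add: x)
  next
    fix x assume x: "x \<in> ?R'"
    then have "d dvd x (Suc m)" using d by blast
    then obtain q where q: "x (Suc m) = q * d" by (metis dvd_div_mult_self)
    \<comment> \<open>Subtracting the right multiple of \<open>u\<close> clears the last
      coordinate.\<close>
    have "(\<lambda>i. x i - q * u i) \<in> ?R"
      using relations_diff[OF x relations_smult[OF u(1), of q]] q u by (simp add: sub)
    then obtain c where c: "\<forall>j\<ge>m. c j = 0" and xc: "(\<lambda>i. x i - q * u i) = (\<lambda>i. \<Sum>j<m. c j * b j i)"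
      using b unfolding bij_betw_def by blast
    have "x = (\<lambda>i. (\<Sum>j<m. ((c(m := q))(m := 0)) j * b j i) + (c(m := q)) m * u i)"
      using fun_cong[OF xc] by (auto simp: fun_eq_iff algebra_simps)
    moreover have "c(m := q) \<in> {c. \<forall>j\<ge>Suc m. c j = 0}" using c by auto
    ultimately show "x \<in> ?F ` {c. \<forall>j\<ge>Suc m. c j = 0}"
      by (rule image_eqI)
  qed
  then show ?case by blast
qed

lemma lattice_free:
  assumes "0 < k" "\<And>i. i < k \<Longrightarrow> 0 < l i"
  shows "lattice_HL k l \<cong> free_Abelian_group {..<k - 1}"
proof -
  obtain m where k: "k = Suc m" using assms(1) by (cases k) auto
  obtain b where b: "bij_betw (\<lambda>c i. \<Sum>j<m. c j * b j i) {c. \<forall>j\<ge>m. c j = 0} (relations k l)"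
    using relations_basis[of m l] assms by (auto simp: k)
  define f where "f c = (\<lambda>i. \<Sum>j<m. poly_mapping.lookup c j * b j i)" for c
  \<comment> \<open>Elements of the free abelian group correspond to coefficient functions vanishing
    from \<open>m\<close> on; finiteness of the support is automatic for these.\<close>
  have lookup: "bij_betw poly_mapping.lookup (carrier (free_Abelian_group {..<m})) {c. \<forall>j\<ge>m. c j = (0::int)}"
  proof (rule bij_betw_imageI)
    show "inj_on poly_mapping.lookup (carrier (free_Abelian_group {..<m}))"
      by (auto intro!: inj_onI poly_mapping_eqI)
    have "c \<in> poly_mapping.lookup ` carrier (free_Abelian_group {..<m})"
      if c: "\<forall>j\<ge>m. c j = 0" for c :: "nat \<Rightarrow> int"
    proof -
      have sub: "{j. c j \<noteq> 0} \<subseteq> {..<m}" using c by (auto simp: not_le[symmetric])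
      then have "finite {j. c j \<noteq> 0}" by (rule finite_subset) simp
      then have "poly_mapping.lookup (Abs_poly_mapping c) = c"
        by (simp add: Abs_poly_mapping_inverse)
      moreover from this have "Abs_poly_mapping c \<in> carrier (free_Abelian_group {..<m})"
        using sub by (simp add: keys.rep_eq)
      ultimately show ?thesis by (metis imageI)
    qed
    then show "poly_mapping.lookup ` carrier (free_Abelian_group {..<m}) = {c. \<forall>j\<ge>m. c j = (0::int)}"
      by (force simp: in_keys_iff subset_iff not_less[symmetric])
  qed
  have "f = (\<lambda>c i. \<Sum>j<m. c j * b j i) \<circ> poly_mapping.lookup"
    by (simp add: f_def fun_eq_iff)
  then have "bij_betw f (carrier (free_Abelian_group {..<m})) (relations k l)"
    using bij_betw_trans[OF lookup b] by simp
  moreover from this have "f \<in> hom (free_Abelian_group {..<m}) (lattice_HL k l)"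
    unfolding hom_def
    by (auto simp: carrier_lattice bij_betw_def)
      (auto simp: lattice_HL_def f_def lookup_add distrib_right sum.distrib)
  ultimately have "f \<in> iso (free_Abelian_group {..<m}) (lattice_HL k l)"
    by (simp add: iso_def carrier_lattice)
  then show ?thesis
    using group.iso_sym[OF group_free_Abelian_group] by (auto simp: is_iso_def k)
qed

theorem theorem4p2:
  fixes k n :: nat and l :: "nat \<Rightarrow> nat"
  assumes "k \<ge> 2"
    and "\<forall>i<k. l i > 0"
    and "generic k l"
    and "reduced k l"
    and "n = (\<Sum>i<k. l i)"
  shows "\<exists>\<phi>. \<phi> \<in> iso (H1_tonn n k l) (lattice_HL k l) \<and>
           (\<forall>y ts p0. y < n \<longrightarrow> set ts \<subseteq> {..<k} \<longrightarrow>
              (\<Sum>i<k. count (mset ts) i * l i) = p0 * n \<longrightarrow>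
              \<phi> (r_coset ((chain_group n k l 1)\<lparr>carrier := cycles1 n k l\<rparr>)
                           (boundaries1 n k l) (path_chain n l y ts))
                = (\<lambda>i. if i < k then int (count (mset ts) i) - int p0 else 0))
         \<and> lattice_HL k l \<cong> free_Abelian_group {..<k - 1}"
proof -
  interpret tonnetz k n l
    using assms by unfold_locales auto
  have "lattice_HL k l \<cong> free_Abelian_group {..<k - 1}"
    using lattice_free assms by simp
  then show ?thesis
    using winding_iso winding_coset winding_closed_path(2)
    by (intro exI[of _ "\<lambda>A. the_elem (winding ` A)"]) simp
qed

end
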